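(* Let $\alpha,\beta,\gamma,\delta\in\mathbb{R}$, let $\mu_1$ be a positive Borel measure on $\mathbb{R}$, and let $\mu$ be the positive Borel measure on $\mathbb{R}^2$ defined for any Borel measurable subset $U\subseteq\mathbb{R}^2$ by $$\mu(U):=\int_{\mathbb{R}}\left(\int_{\mathbb{R}}\chi_U(\alpha t_1+\beta t_2,\gamma t_1+\delta t_2)\,\mathrm{d}t_2\right)\mathrm{d}\mu_1(t_1).$$ Say that $\mu_1$ satisfies the growth condition (G) if $\int_{\mathbb{R}}\frac{1}{1+t^2}\,\mathrm{d}\mu_1(t)<\infty$. Then $\mu$ is the representing measure of some Herglotz-Nevanlinna function in two variables if and only if one of the following cases holds: (i.1) $\alpha=0$, $\beta=0$, $\delta\neq0$ and $\mu_1$ is a finite positive Borel measure on $\mathbb{R}$; (i.2) $\alpha\neq0$, $\beta=0$, $\delta\neq0$ and $\mu_1$ is a positive Borel measure on $\mathbb{R}$ satisfying (G); (ii.1) $\beta\neq0$, $\gamma=0$, $\delta=0$ and $\mu_1$ is a finite positive Borel measure on $\mathbb{R}$; (ii.2) $\beta\neq0$, $\gamma\neq0$, $\delta=0$ and $\mu_1$ is a positive Borel measure on $\mathbb{R}$ satisfying (G); (iii.1.a) $\beta\delta<0$, $\alpha\delta-\beta\gamma=0$ and $\mu_1$ is a finite positive Borel measure on $\mathbb{R}$; (iii.1.b) $\beta\delta<0$, $\alpha\delta-\beta\gamma\neq0$ and $\mu_1$ is a positive Borel measure on $\mathbb{R}$ satisfying (G); (iii.2.a) $\beta\delta>0$,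 $\alpha\delta-\beta\gamma=0$ and $\mu_1$ is identically zero; (iii.2.b) $\beta\delta>0$, $\alpha\delta-\beta\gamma\neq0$ and $\mu_1$ is a positive Borel measure on $\mathbb{R}$ satisfying (G) and the condition that $$\int_{\mathbb{R}}\frac{1}{((\alpha\delta-\beta\gamma)t_1-\delta z_1+\beta\overline{z_2})^3}\,\mathrm{d}\mu_1(t_1)=0\quad\text{for all }z_1,z_2\in\mathbb{C}^+.$$
   Context: $\mathbb{C}^+$ is the open upper half-plane, $\mathbb{C}^{+2}:=(\mathbb{C}^+)^2$, and $\chi_U$ is the indicator function of $U$. A Herglotz-Nevanlinna function in two variables is a holomorphic function on $\mathbb{C}^{+2}$ with non-negative imaginary part. In the definition of $\mu$, and in integrals with respect to $\mu$, the inner integral in $t_2$ (with respect to Lebesgue measure) is always taken first. With $$K_2(\vec z,\vec t):=\mathrm{i}\left(\frac{2}{(2\mathrm{i})^2}\prod_{j=1}^2\left(\frac{1}{t_j-z_j}-\frac{1}{t_j+\mathrm{i}}\right)-\frac{1}{(2\mathrm{i})^2}\prod_{j=1}^2\left(\frac{1}{t_j-\mathrm{i}}-\frac{1}{t_j+\mathrm{i}}\right)\right),$$ it is a known theorem that $q\colon\mathbb{C}^{+2}\to\mathbb{C}$ is a Herglotz-Nevanlinna function if and only if $$q(\vec z)=a+b_1z_1+b_2z_2+\frac{1}{\pi^2}\int_{\mathbb{R}^2}K_2(\vec z,\vec t)\,\mathrm{d}\mu(\vec t),\qquad \vec z\in\mathbb{C}^{+2},$$ where $a\in\mathbb{R}$,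 $b_1,b_2\ge0$ and $\mu$ is a positive Borel measure on $\mathbb{R}^2$ satisfying the growth condition $\int_{\mathbb{R}^2}\frac{1}{(1+t_1^2)(1+t_2^2)}\,\mathrm{d}\mu(\vec t)<\infty$ and the Nevanlinna condition $$\int_{\mathbb{R}^2}\frac{1}{(t_1-z_1)^2(t_2-\overline{z_2})^2}\,\mathrm{d}\mu(\vec t)=0\quad\text{for all }(z_1,z_2)\in\mathbb{C}^{+2}.$$ The parameters $a,b_1,b_2,\mu$ are unique for a given $q$, and $\mu$ is called the representing measure of $q$.
   Formalization: The case β = δ = 0 with μ₁ identically zero is excluded: there μ = 0 is the representing measure of q = 0, although none of the listed cases holds, so the equivalence as printed fails exactly in that case. *)

theory Defs
  imports "HOL-Analysis.Analysis"
begin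

definition upper_half_plane :: "complex set" where
  "upper_half_plane = {z. 0 < Im z}"

text \<open>Holomorphy of a function of two variables is complex (Frechet) differentiability, i.e. real
  differentiability with a complex-linear derivative. Values outside the domain are irrelevant, since
  the domain is open.\<close>

definition holomorphic2_on :: "(complex \<times> complex \<Rightarrow> complex) \<Rightarrow> (complex \<times> complex) set \<Rightarrow> bool" where
  "holomorphic2_on q S \<longleftrightarrow>
     (\<forall>z\<in>S. \<exists>c1 c2. (q has_derivative (\<lambda>h. c1 * fst h + c2 * snd h)) (at z))"

definition herglotz_nevanlinna2 :: "(complex \<times> complex \<Rightarrow> complex) \<Rightarrow> bool" where
  "herglotz_nevanlinna2 q \<longleftrightarrow>
     holomorphic2_on q (upper_half_plane \<times> upper_half_plane) \<and>
     (\<forall>z \<in> upper_half_plane \<times> upper_half_plane. 0 \<le> Im (q z))"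

definition kernel2 :: "complex \<times> complex \<Rightarrow> real \<times> real \<Rightarrow> complex" where
  "kernel2 z t =
     \<i> * (2 / (2 * \<i>)^2 *
            ((1 / (of_real (fst t) - fst z) - 1 / (of_real (fst t) + \<i>)) *
             (1 / (of_real (snd t) - snd z) - 1 / (of_real (snd t) + \<i>)))
          - 1 / (2 * \<i>)^2 *
            ((1 / (of_real (fst t) - \<i>) - 1 / (of_real (fst t) + \<i>)) *
             (1 / (of_real (snd t) - \<i>) - 1 / (of_real (snd t) + \<i>))))"

definition growth_cond2 :: "(real \<times> real) measure \<Rightarrow> bool" where
  "growth_cond2 \<mu> \<longleftrightarrow>
     (\<integral>\<^sup>+ t. ennreal (1 / ((1 + (fst t)^2) * (1 + (snd t)^2))) \<partial>\<mu>) < \<infinity>"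

text \<open>Under the growth condition the integrands below and in \<open>representing_measure2\<close> are absolutely
  integrable, so that the Bochner integral never takes its default value.\<close>

definition nevanlinna_cond2 :: "(real \<times> real) measure \<Rightarrow> bool" where
  "nevanlinna_cond2 \<mu> \<longleftrightarrow>
     (\<forall>z1 \<in> upper_half_plane. \<forall>z2 \<in> upper_half_plane.
        (LINT t|\<mu>. 1 / ((of_real (fst t) - z1)^2 * (of_real (snd t) - cnj z2)^2)) = 0)"

definition representing_measure2 ::
    "(real \<times> real) measure \<Rightarrow> (complex \<times> complex \<Rightarrow> complex) \<Rightarrow> bool" where
  "representing_measure2 \<mu> q \<longleftrightarrow>
     sets \<mu> = sets borel \<and> growth_cond2 \<mu> \<and> nevanlinna_cond2 \<mu> \<and>
     (\<exists>(a::real) (b1::real) (b2::real). 0 \<le> b1 \<and> 0 \<le> b2 \<and>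
        (\<forall>z \<in> upper_half_plane \<times> upper_half_plane.
           q z = of_real a + of_real b1 * fst z + of_real b2 * snd z
                 + 1 / of_real (pi^2) * (LINT t|\<mu>. kernel2 z t)))"

definition growth_cond1 :: "real measure \<Rightarrow> bool" where
  "growth_cond1 \<mu>1 \<longleftrightarrow> (\<integral>\<^sup>+ t. ennreal (1 / (1 + t^2)) \<partial>\<mu>1) < \<infinity>"

text \<open>The measure is given by its values, not as the image of a product measure, because the
  first factor need not be sigma-finite.\<close>

definition line_measure ::
    "real \<Rightarrow> real \<Rightarrow> real \<Rightarrow> real \<Rightarrow> real measure \<Rightarrow> (real \<times> real) measure" where
  "line_measure \<alpha> \<beta> \<gamma> \<delta> \<mu>1 = measure_of UNIV (sets borel)
     (\<lambda>U. \<integral>\<^sup>+ t1. (\<integral>\<^sup>+ t2. indicator U (\<alpha> * t1 + \<beta> * t2, \<gamma> * t1 + \<delta> * t2) \<partial>lborel) \<partial>\<mu>1)"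

lemma space_line_measure [simp]: "space (line_measure \<alpha> \<beta> \<gamma> \<delta> \<mu>1) = UNIV"
  by (simp add: line_measure_def space_measure_of_conv)

lemma sets_line_measure [simp]: "sets (line_measure \<alpha> \<beta> \<gamma> \<delta> \<mu>1) = sets borel"
  unfolding line_measure_def
  using sets.sigma_sets_eq[of "borel :: (real \<times> real) measure"]
  by (simp add: sets_measure_of_conv)

lemma emeasure_line_measure:
  assumes \<mu>1: "sets \<mu>1 = sets borel" and U: "U \<in> sets borel"
  shows "emeasure (line_measure \<alpha> \<beta> \<gamma> \<delta> \<mu>1) U =
    (\<integral>\<^sup>+ t1. (\<integral>\<^sup>+ t2. indicator U (\<alpha> * t1 + \<beta> * t2, \<gamma> * t1 + \<delta> * t2) \<partial>lborel) \<partial>\<mu>1)"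
proof (rule emeasure_measure_of[OF line_measure_def])
  let ?T = "\<lambda>t1 t2. (\<alpha> * t1 + \<beta> * t2, \<gamma> * t1 + \<delta> * t2)"
  let ?m = "\<lambda>U. \<integral>\<^sup>+ t1. (\<integral>\<^sup>+ t2. indicator U (?T t1 t2) \<partial>lborel) \<partial>\<mu>1"
  have T: "(\<lambda>(t1, t2). ?T t1 t2) \<in> borel \<Otimes>\<^sub>M borel \<rightarrow>\<^sub>M borel"
    unfolding borel_prod by (intro borel_measurable_continuous_onI)
      (auto simp: case_prod_beta intro!: continuous_intros)
  show "countably_additive (sets (line_measure \<alpha> \<beta> \<gamma> \<delta> \<mu>1)) ?m"
    unfolding sets_line_measure countably_additive_def
  proof (intro allI impI)
    fix A :: "nat \<Rightarrow> (real \<times> real) set"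
    assume A: "range A \<subseteq> sets borel" and disj: "disjoint_family A"
    have A': "A i \<in> sets borel" for i using A by auto
    have ind: "(\<lambda>(t1, t2). indicator (A i) (?T t1 t2) :: ennreal)
        \<in> borel_measurable (\<mu>1 \<Otimes>\<^sub>M lborel)" for i
    proof -
      have "(\<lambda>x. indicator (A i) ((\<lambda>(t1, t2). ?T t1 t2) x) :: ennreal)
          \<in> borel_measurable (borel \<Otimes>\<^sub>M borel)"
        by (rule measurable_compose[OF T]) (use A' in simp)
      also have "borel_measurable (borel \<Otimes>\<^sub>M borel :: (real \<times> real) measure)
          = borel_measurable (\<mu>1 \<Otimes>\<^sub>M lborel)"
        by (intro measurable_cong_sets sets_pair_measure_cong) (auto simp: \<mu>1)
      finally show ?thesis by (simp add: case_prod_beta)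
    qed
    have inner: "(\<lambda>t2. indicator (A i) (?T t1 t2) :: ennreal) \<in> borel_measurable lborel" for i t1
      using measurable_compose_Pair1[OF _ ind, of t1 i] sets_eq_imp_space_eq[OF \<mu>1] by simp
    have outer: "(\<lambda>t1. \<integral>\<^sup>+ t2. indicator (A i) (?T t1 t2) \<partial>lborel) \<in> borel_measurable \<mu>1" for i
      using lborel.borel_measurable_nn_integral[OF ind] .
    have "(\<Sum>i. ?m (A i)) = (\<integral>\<^sup>+ t1. (\<Sum>i. \<integral>\<^sup>+ t2. indicator (A i) (?T t1 t2) \<partial>lborel) \<partial>\<mu>1)"
      by (rule nn_integral_suminf[symmetric]) (rule outer)
    also have "\<dots> = (\<integral>\<^sup>+ t1. (\<integral>\<^sup>+ t2. (\<Sum>i. indicator (A i) (?T t1 t2)) \<partial>lborel) \<partial>\<mu>1)"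
      by (simp add: nn_integral_suminf[OF inner])
    also have "\<dots> = ?m (\<Union>i. A i)"
      by (simp add: suminf_indicator[OF disj])
    finally show "(\<Sum>i. ?m (A i)) = ?m (\<Union>i. A i)" .
  qed
qed (use U in \<open>auto simp: positive_def\<close>)

end

theory Submission
  imports Defs "HOL-Probability.Sinc_Integral"
begin

text \<open>A Borel measure is the representing measure of some Herglotz-Nevanlinna function iff it satisfies
  the growth and the Nevanlinna condition. For the converse direction take \<open>a = b\<^sub>1 = b\<^sub>2 = 0\<close>:
  differentiating under the integral shows that the Nevanlinna condition also annihilates
  \<open>M\<^sub>1 M\<^sub>2\<close> with \<open>M\<^sub>1 = 1/(t\<^sub>1 - z\<^sub>1) - 1/(t\<^sub>1 - \<i>)\<close> and \<open>M\<^sub>2 = 1/(t\<^sub>2 - cnj z\<^sub>2) - 1/(t\<^sub>2 + \<i>)\<close>, and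
  \<open>Im K\<^sub>2\<close> is the product Poisson kernel minus half the real part of \<open>M\<^sub>1 M\<^sub>2\<close>.

  For the measure in question both conditions are decided by the inner integral in \<open>t\<^sub>2\<close>. With
  \<open>D = \<alpha>\<delta> - \<beta>\<gamma>\<close>, the inner integral of the growth weight is comparable to \<open>1/(1 + D\<^sup>2 t\<^sub>1\<^sup>2)\<close>. The inner
  integral of the Nevanlinna kernel has two double poles: it vanishes if they lie in the same
  half-plane (\<open>\<beta>\<delta> < 0\<close>) or if one of them is absent (\<open>\<beta>\<delta> = 0\<close>), and otherwise it is a nonzero multiple of
  \<open>1/(D t\<^sub>1 - \<delta> z\<^sub>1 + \<beta> cnj z\<^sub>2)\<^sup>3\<close>.\<close>

section \<open>Regularised Cauchy transforms\<close>

text \<open>Subtracting the Cauchy kernel at a base point \<open>c\<close> improves the decay in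
  \<open>t\<close> from order \<open>1/t\<close> to order \<open>1/t^2\<close>, which matches the
  growth condition, and makes the expression vanish at \<open>z = c\<close>.\<close>

definition reg_cauchy :: "complex \<Rightarrow> complex \<Rightarrow> real \<Rightarrow> complex" where
  "reg_cauchy c z t = 1 / (of_real t - z) - 1 / (of_real t - c)"

section \<open>Pointwise bounds for Cauchy kernels\<close>

lemma of_real_minus_neq_0: "Im z \<noteq> 0 \<Longrightarrow> of_real t - z \<noteq> 0"
  by (auto simp: complex_eq_iff)

lemma reg_cauchy_eq:
  "Im z \<noteq> 0 \<Longrightarrow> Im c \<noteq> 0 \<Longrightarrow> reg_cauchy c z t = (z - c) * (1 / (of_real t - z) * (1 / (of_real t - c)))"
  using of_real_minus_neq_0[of z t] of_real_minus_neq_0[of c t]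
  by (simp add: reg_cauchy_def field_simps)

lemma measurable_reg_cauchy [measurable]:
  assumes [measurable]: "f \<in> borel_measurable M"
  shows "(\<lambda>x. reg_cauchy c z (f x)) \<in> borel_measurable M"
  unfolding reg_cauchy_def by measurable

text \<open>Each Cauchy factor is worth one square root of the weight \<open>1/(1 + t^2)\<close>, so
  a product of two is dominated by that weight. The constant comes from
  \<open>|t + i| <= |t - z| + |z + i|\<close> together with
  \<open>|Im z| <= |t - z|\<close>.\<close>

lemma norm_inverse_cauchy_le:
  assumes "Im z \<noteq> 0"
  obtains C where "C > 0" "\<And>t. norm (1 / (of_real t - z)) \<le> C / sqrt (1 + t\<^sup>2)"
proof
  let ?C = "1 + norm (z + \<i>) / \<bar>Im z\<bar>"
  show "?C > 0" using assms by (auto intro!: add_pos_nonneg)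
  fix t :: real
  have "sqrt (1 + t\<^sup>2) = norm (of_real t + \<i>)" by (simp add: cmod_def add.commute)
  also have "\<dots> \<le> norm (of_real t - z) + norm (z + \<i>)"
    using norm_triangle_ineq[of "of_real t - z" "z + \<i>"] by simp
  also have "\<dots> \<le> norm (of_real t - z) + norm (of_real t - z) * (norm (z + \<i>) / \<bar>Im z\<bar>)"
  proof -
    have "\<bar>Im z\<bar> \<le> norm (of_real t - z)" using abs_Im_le_cmod[of "of_real t - z"] by simp
    then have "\<bar>Im z\<bar> * (norm (z + \<i>) / \<bar>Im z\<bar>) \<le> norm (of_real t - z) * (norm (z + \<i>) / \<bar>Im z\<bar>)"
      by (intro mult_right_mono) auto
    then show ?thesis using assms by simp
  qed
  finally have "sqrt (1 + t\<^sup>2) \<le> norm (of_real t - z) * ?C" by (simp add: algebra_simps)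
  moreover have "0 < sqrt (1 + t\<^sup>2)" by (simp add: add_pos_nonneg)
  ultimately show "norm (1 / (of_real t - z)) \<le> ?C / sqrt (1 + t\<^sup>2)"
    using of_real_minus_neq_0[OF assms, of t] by (simp add: norm_divide divide_simps mult.commute)
qed

text \<open>Moving the pole by at most half its distance to the real line shrinks the denominator by
  a factor of at most two. The bound is uniform in \<open>h\<close>, as the domination of difference
  quotients requires.\<close>

lemma norm_inverse_cauchy_perturb:
  assumes "Im z \<noteq> 0" and h: "norm h \<le> \<bar>Im z\<bar> / 2"
  shows "of_real t - (z + h) \<noteq> 0"
    "norm (1 / (of_real t - (z + h))) \<le> 2 * norm (1 / (of_real t - z))"
proof -
  let ?a = "of_real t - z"
  have 1: "\<bar>Im z\<bar> \<le> norm ?a" using abs_Im_le_cmod[of ?a] by simp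
  have 2: "norm (?a - h) \<ge> norm ?a / 2" using norm_triangle_ineq2[of ?a h] 1 h by linarith
  have eq: "?a - h = of_real t - (z + h)" by simp
  have 3: "norm ?a > 0" using of_real_minus_neq_0[OF assms(1), of t] by simp
  then show "of_real t - (z + h) \<noteq> 0" using 2 unfolding eq[symmetric] by fastforce
  have "1 / norm (?a - h) \<le> 1 / (norm ?a / 2)" using 2 3 by (intro divide_left_mono mult_pos_pos) auto
  then show "norm (1 / (of_real t - (z + h))) \<le> 2 * norm (1 / ?a)"
    unfolding eq[symmetric] by (simp add: norm_divide)
qed

text \<open>Two rounds of the resolvent identity: the first exposes the difference quotient, the
  second splits it into the derivative and a remainder of order \<open>h\<close>.\<close>

lemma reg_cauchy_add:
  assumes "Im z \<noteq> 0" "norm h \<le> \<bar>Im z\<bar> / 2"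
  shows "reg_cauchy c (z + h) t = reg_cauchy c z t + h * (1 / (of_real t - z) * (1 / (of_real t - (z + h))))"
    and "1 / (of_real t - z) * (1 / (of_real t - (z + h))) =
      1 / (of_real t - z)\<^sup>2 + h * (1 / (of_real t - z)\<^sup>2 * (1 / (of_real t - (z + h))))"
proof -
  define a where "a = of_real t - z"
  define b where "b = of_real t - (z + h)"
  have ab: "a \<noteq> 0" "b \<noteq> 0" "h = a - b"
    using of_real_minus_neq_0[OF assms(1)] norm_inverse_cauchy_perturb(1)[OF assms]
    by (auto simp: a_def b_def)
  have "1 / b = 1 / a + (a - b) * (1 / a * (1 / b))"
    "1 / a * (1 / b) = 1 / a\<^sup>2 + (a - b) * (1 / a\<^sup>2 * (1 / b))"
    using ab(1,2) by (simp_all add: field_simps power2_eq_square)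
  note eq = this[folded ab(3), unfolded a_def b_def]
  show "reg_cauchy c (z + h) t = reg_cauchy c z t + h * (1 / (of_real t - z) * (1 / (of_real t - (z + h))))"
    unfolding reg_cauchy_def by (subst eq(1)) (simp only: diff_add_eq)
  show "1 / (of_real t - z) * (1 / (of_real t - (z + h))) =
      1 / (of_real t - z)\<^sup>2 + h * (1 / (of_real t - z)\<^sup>2 * (1 / (of_real t - (z + h))))"
    by (fact eq(2))
qed

text \<open>With one constant for all four kernels, a single multiple of the weight dominates every
  term of the expansions in \<open>h\<close>.\<close>

lemma cauchy_kernel_bounds:
  assumes z: "Im z \<noteq> 0" and c: "Im c \<noteq> 0"
  obtains C where "C > 0"
    "\<And>t. norm (reg_cauchy c z t) \<le> C / (1 + t\<^sup>2)"
    "\<And>t. norm (1 / (of_real t - z)\<^sup>2) \<le> C / (1 + t\<^sup>2)"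
    "\<And>t h. norm h \<le> \<bar>Im z\<bar> / 2 \<Longrightarrow>
      norm (1 / (of_real t - z) * (1 / (of_real t - (z + h)))) \<le> C / (1 + t\<^sup>2)"
    "\<And>t h. norm h \<le> \<bar>Im z\<bar> / 2 \<Longrightarrow>
      norm (1 / (of_real t - z)\<^sup>2 * (1 / (of_real t - (z + h)))) \<le> C / (1 + t\<^sup>2)"
proof -
  obtain A where A: "A > 0" "\<And>t. norm (1 / (of_real t - z)) \<le> A / sqrt (1 + t\<^sup>2)"
    using norm_inverse_cauchy_le[OF z] by metis
  obtain B where B: "B > 0" "\<And>t. norm (1 / (of_real t - c)) \<le> B / sqrt (1 + t\<^sup>2)"
    using norm_inverse_cauchy_le[OF c] by metis
  \<comment> \<open>The four summands are, in order, the constants for the four claims; all are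
    non-negative, so each is at most \<open>C\<close>.\<close>
  define C where "C = norm (z - c) * (A * B) + A * A + A * (2 * A) + 2 / \<bar>Im z\<bar> * (A * A)"
  have parts: "0 \<le> norm (z - c) * (A * B)" "0 < A * A" "0 \<le> 2 / \<bar>Im z\<bar> * (A * A)"
    using A(1) B(1) by auto
  have prod: "X * Y \<le> (P * Q) / (1 + t\<^sup>2)"
    if "X \<le> P / sqrt (1 + t\<^sup>2)" "Y \<le> Q / sqrt (1 + t\<^sup>2)" "0 \<le> Y" "0 \<le> P" for X Y P Q t :: real
  proof -
    have "X * Y \<le> (P / sqrt (1 + t\<^sup>2)) * (Q / sqrt (1 + t\<^sup>2))"
      using that by (intro mult_mono) auto
    then show ?thesis by (simp add: add_nonneg_nonneg)
  qed
  have weaken: "X \<le> C / (1 + t\<^sup>2)" if "X \<le> D / (1 + t\<^sup>2)" "D \<le> C" for X D t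
    using that(1) divide_right_mono[OF that(2), of "1 + t\<^sup>2"] by simp
  have AA: "norm (1 / (of_real t - z)) * norm (1 / (of_real t - z)) \<le> A * A / (1 + t\<^sup>2)" for t
    using A by (intro prod) auto
  show ?thesis
  proof (rule that[of C])
    show "C > 0" unfolding C_def using parts by linarith
    fix t :: real
    have "norm (1 / (of_real t - z)) * norm (1 / (of_real t - c)) \<le> A * B / (1 + t\<^sup>2)"
      using A B by (intro prod) auto
    from mult_left_mono[OF this, of "norm (z - c)"]
    show "norm (reg_cauchy c z t) \<le> C / (1 + t\<^sup>2)"
      unfolding reg_cauchy_eq[OF z c] norm_mult
      by (intro weaken[of _ "norm (z - c) * (A * B)"]) (use parts in \<open>auto simp: C_def\<close>)
    show "norm (1 / (of_real t - z)\<^sup>2) \<le> C / (1 + t\<^sup>2)"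
      using AA[of t] by (intro weaken[of _ "A * A"])
        (use parts in \<open>auto simp: C_def norm_divide norm_mult power2_eq_square\<close>)
    fix h :: complex assume h: "norm h \<le> \<bar>Im z\<bar> / 2"
    have le: "norm (1 / (of_real t - (z + h))) \<le> (2 * A) / sqrt (1 + t\<^sup>2)"
      using norm_inverse_cauchy_perturb(2)[OF z h, of t] A(2)[of t] by simp
    have "norm (1 / (of_real t - z)) * norm (1 / (of_real t - (z + h))) \<le> A * (2 * A) / (1 + t\<^sup>2)"
      using A le by (intro prod) auto
    then show "norm (1 / (of_real t - z) * (1 / (of_real t - (z + h)))) \<le> C / (1 + t\<^sup>2)"
      unfolding norm_mult by (intro weaken[of _ "A * (2 * A)"]) (use parts in \<open>auto simp: C_def\<close>)
    \<comment> \<open>Of the three Cauchy factors in the last kernel, two produce the weight and the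
      perturbed one is only bounded by \<open>2 / |Im z|\<close>.\<close>
    have Im: "\<bar>Im z\<bar> \<le> norm (of_real t - z)" using abs_Im_le_cmod[of "of_real t - z"] by simp
    have "norm (1 / (of_real t - z)) \<le> 1 / \<bar>Im z\<bar>"
      unfolding norm_divide norm_one using Im z by (intro divide_left_mono mult_pos_pos) auto
    then have "norm (1 / (of_real t - (z + h))) \<le> 2 / \<bar>Im z\<bar>"
      using norm_inverse_cauchy_perturb(2)[OF z h, of t] by simp
    then have "norm (1 / (of_real t - (z + h))) * (norm (1 / (of_real t - z)) * norm (1 / (of_real t - z)))
        \<le> 2 / \<bar>Im z\<bar> * (A * A / (1 + t\<^sup>2))"
      using AA[of t] by (intro mult_mono) auto
    then show "norm (1 / (of_real t - z)\<^sup>2 * (1 / (of_real t - (z + h)))) \<le> C / (1 + t\<^sup>2)"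
      by (intro weaken[of _ "2 / \<bar>Im z\<bar> * (A * A)"])
        (use parts in \<open>auto simp: C_def norm_mult norm_divide norm_power power2_eq_square mult_ac\<close>)
  qed
qed

text \<open>Differentiation under the integral by an exact second-order expansion: the remainder is
  \<open>h^2\<close> times an integral that is bounded independently of \<open>h\<close>. The factor
  \<open>B\<close> stands for the kernel in the other variable, which is kept fixed.\<close>

lemma cauchy_transform_has_field_derivative:
  fixes f :: "'a \<Rightarrow> real" and B :: "'a \<Rightarrow> complex"
  assumes [measurable]: "f \<in> borel_measurable M" "B \<in> borel_measurable M"
    and int: "integrable M (\<lambda>x. norm (B x) / (1 + (f x)\<^sup>2))"
    and z: "Im z \<noteq> 0" and c: "Im c \<noteq> 0"
  shows "((\<lambda>w. LINT x|M. reg_cauchy c w (f x) * B x) has_field_derivative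
           (LINT x|M. 1 / (of_real (f x) - z)\<^sup>2 * B x)) (at z)"
proof -
  obtain C where C: "C > 0"
    "\<And>t. norm (reg_cauchy c z t) \<le> C / (1 + t\<^sup>2)"
    "\<And>t. norm (1 / (of_real t - z)\<^sup>2) \<le> C / (1 + t\<^sup>2)"
    "\<And>t h. norm h \<le> \<bar>Im z\<bar> / 2 \<Longrightarrow>
      norm (1 / (of_real t - z)\<^sup>2 * (1 / (of_real t - (z + h)))) \<le> C / (1 + t\<^sup>2)"
    using cauchy_kernel_bounds[OF z c] by metis
  define J where "J = (LINT x|M. C * (norm (B x) / (1 + (f x)\<^sup>2)))"
  have dom: "integrable M (\<lambda>x. C * (norm (B x) / (1 + (f x)\<^sup>2)))"
    using int by (rule integrable_mult_right)
  have bnd: "norm (g * B x) \<le> C * (norm (B x) / (1 + (f x)\<^sup>2))"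
    if "norm g \<le> C / (1 + (f x)\<^sup>2)" for g x
    using mult_right_mono[OF that, of "norm (B x)"] by (simp add: norm_mult)
  have dom': "integrable M (\<lambda>x. g x * B x)"
    if [measurable]: "g \<in> borel_measurable M" and "\<And>x. norm (g x) \<le> C / (1 + (f x)\<^sup>2)" for g
    using dom by (rule Bochner_Integration.integrable_bound)
      (use C(1) in \<open>auto intro!: AE_I2 order_trans[OF bnd[OF that(2)]] simp: abs_mult\<close>)
  have int2: "integrable M (\<lambda>x. 1 / (of_real (f x) - z)\<^sup>2 * B x)"
    and int1: "integrable M (\<lambda>x. reg_cauchy c z (f x) * B x)"
    by (rule dom', measurable, rule C)+
  let ?F = "\<lambda>w. LINT x|M. reg_cauchy c w (f x) * B x"
  let ?D = "LINT x|M. 1 / (of_real (f x) - z)\<^sup>2 * B x"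
  have key: "norm (?F (z + h) - ?F z - ?D * h) \<le> norm h * norm h * J" if h: "norm h \<le> \<bar>Im z\<bar> / 2" for h
  proof -
    let ?r = "\<lambda>x. 1 / (of_real (f x) - z)\<^sup>2 * (1 / (of_real (f x) - (z + h)))"
    have int3: "integrable M (\<lambda>x. ?r x * B x)"
      by (rule dom', measurable, rule C(4)[OF h])
    have "reg_cauchy c (z + h) t = reg_cauchy c z t + h * (1 / (of_real t - z)\<^sup>2)
        + h * h * (1 / (of_real t - z)\<^sup>2 * (1 / (of_real t - (z + h))))" for t
      unfolding reg_cauchy_add(1)[OF z h] reg_cauchy_add(2)[OF z h] by (simp only: distrib_left mult.assoc add.assoc)
    then have "?F (z + h) = (LINT x|M. reg_cauchy c z (f x) * B x
        + h * (1 / (of_real (f x) - z)\<^sup>2 * B x) + h * h * (?r x * B x))"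
      by (intro Bochner_Integration.integral_cong refl) (simp only: distrib_right mult.assoc)
    also have "\<dots> = ?F z + h * ?D + h * h * (LINT x|M. ?r x * B x)"
      by (simp only: int1 int2 int3 Bochner_Integration.integral_add Bochner_Integration.integrable_add
          integrable_mult_right integral_mult_right_zero)
    finally have eq: "?F (z + h) - ?F z - ?D * h = h * h * (LINT x|M. ?r x * B x)" by simp
    have "norm (LINT x|M. ?r x * B x) \<le> J"
      unfolding J_def using int3 dom
      by (intro order_trans[OF integral_norm_bound integral_mono] integrable_norm bnd[OF C(4)[OF h]])
    then show ?thesis unfolding eq norm_mult by (intro mult_left_mono) auto
  qed
  have J: "J \<ge> 0" unfolding J_def using C(1) by (intro integral_nonneg_AE AE_I2) auto
  show ?thesis unfolding has_field_derivative_def has_derivative_at_alt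
  proof (intro conjI allI impI)
    show "bounded_linear ((*) ?D)" by (rule bounded_linear_mult_right)
    fix e :: real assume e: "e > 0"
    \<comment> \<open>The first bound keeps the perturbed pole off the real line; the second turns
      the remainder \<open>|h|^2 J\<close> into at most \<open>e |h|\<close>. The \<open>+ 1\<close>
      covers \<open>J = 0\<close>.\<close>
    define d where "d = min (\<bar>Im z\<bar> / 2) (e / (J + 1))"
    have d: "d > 0" unfolding d_def using z e J by simp
    have "norm (?F y - ?F z - ?D * (y - z)) \<le> e * norm (y - z)" if "norm (y - z) < d" for y
    proof -
      have y: "norm (y - z) \<le> \<bar>Im z\<bar> / 2" "norm (y - z) \<le> e / (J + 1)" using that by (auto simp: d_def)
      have "norm (y - z) * J \<le> e / (J + 1) * (J + 1)"
        using y(2) J e by (intro mult_mono) auto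
      then have "norm (y - z) * J \<le> e" using J by simp
      from mult_left_mono[OF this, of "norm (y - z)"]
      have "norm (y - z) * norm (y - z) * J \<le> e * norm (y - z)" by (simp add: mult_ac)
      moreover have "norm (?F y - ?F z - ?D * (y - z)) \<le> norm (y - z) * norm (y - z) * J"
        using key[OF y(1)] by simp
      ultimately show ?thesis by linarith
    qed
    then show "\<exists>d>0. \<forall>y. norm (y - z) < d \<longrightarrow> norm (?F y - ?F z - ?D * (y - z)) \<le> e * norm (y - z)"
      using d by blast
  qed
qed

text \<open>The sign of \<open>s\<close> selects the half-plane: the Nevanlinna condition has \<open>z\<^sub>1\<close> in the upper one and
  the conjugate of \<open>z\<^sub>2\<close> in the lower one.\<close>

lemma reg_cauchy_integral_eq_0:
  fixes f :: "'a \<Rightarrow> real" and B :: "'a \<Rightarrow> complex" and s :: real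
  assumes "f \<in> borel_measurable M" "B \<in> borel_measurable M"
    and "integrable M (\<lambda>x. norm (B x) / (1 + (f x)\<^sup>2))"
    and 0: "\<And>w. 0 < s * Im w \<Longrightarrow> (LINT x|M. 1 / (of_real (f x) - w)\<^sup>2 * B x) = 0"
    and z: "0 < s * Im z" and c: "0 < s * Im c"
  shows "(LINT x|M. reg_cauchy c z (f x) * B x) = 0"
proof -
  let ?S = "{w. 0 < s * Im w}"
  let ?F = "\<lambda>w. LINT x|M. reg_cauchy c w (f x) * B x"
  \<comment> \<open>A half-plane is convex, so a vanishing derivative forces the transform to be
    constant on it.\<close>
  have "convex {w. inner (Complex 0 s) w > 0}" by (rule convex_halfspace_gt)
  then have "convex ?S" by (simp add: inner_complex_def)
  moreover have "(?F has_field_derivative 0) (at w within ?S)" if "w \<in> ?S" for w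
  proof -
    have "Im w \<noteq> 0" "Im c \<noteq> 0" using that c by auto
    then show ?thesis
      using cauchy_transform_has_field_derivative[OF assms(1-3), of w c] 0[of w] that
      by (auto intro: has_field_derivative_at_within)
  qed
  ultimately obtain k where k: "\<And>w. w \<in> ?S \<Longrightarrow> ?F w = k"
    using has_field_derivative_zero_constant[of ?S ?F] by blast
  \<comment> \<open>The constant is read off at the base point, which is why \<open>c\<close> has to
    lie in the same half-plane as \<open>z\<close>.\<close>
  have "?F c = 0" by (simp add: reg_cauchy_def)
  then show ?thesis using k[of c] k[of z] z c by simp
qed

section \<open>Representing measures\<close>

abbreviation poisson_weight2 :: "real \<times> real \<Rightarrow> real" where
  "poisson_weight2 t \<equiv> 1 / ((1 + (fst t)\<^sup>2) * (1 + (snd t)\<^sup>2))"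

lemma integrable_poisson_weight2:
  assumes "sets \<mu> = sets borel" "growth_cond2 \<mu>"
  shows "integrable \<mu> poisson_weight2"
proof (rule integrableI_bounded)
  have "poisson_weight2 \<in> borel_measurable borel"
    by (intro borel_measurable_continuous_onI continuous_intros)
       (auto simp: add_pos_nonneg less_imp_neq[symmetric] sum_power2_eq_zero_iff add_nonneg_eq_0_iff)
  then show "poisson_weight2 \<in> borel_measurable \<mu>"
    by (simp add: measurable_cong_sets[OF assms(1)])
  show "(\<integral>\<^sup>+ t. ennreal (norm (poisson_weight2 t)) \<partial>\<mu>) < \<infinity>"
    using assms(2) unfolding growth_cond2_def by simp
qed

lemma integrable_poisson_weight2_bound:
  fixes F :: "real \<times> real \<Rightarrow> 'a :: {banach, second_countable_topology}"
  assumes "sets \<mu> = sets borel" "growth_cond2 \<mu>" "F \<in> borel_measurable \<mu>"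
    and "\<And>t. norm (F t) \<le> C * poisson_weight2 t"
  shows "integrable \<mu> F"
proof (rule Bochner_Integration.integrable_bound)
  show "integrable \<mu> (\<lambda>t. C * poisson_weight2 t)"
    by (rule integrable_mult_right) (rule integrable_poisson_weight2[OF assms(1,2)])
  show "AE t in \<mu>. norm (F t) \<le> norm (C * poisson_weight2 t)"
    using assms(4) by (intro AE_I2) (metis abs_ge_self order_trans real_norm_def)
qed fact

lemma fst_snd_borel_measurable:
  assumes "sets \<mu> = sets (borel :: (real \<times> real) measure)"
  shows "(fst :: real \<times> real \<Rightarrow> real) \<in> borel_measurable \<mu>" "(snd :: real \<times> real \<Rightarrow> real) \<in> borel_measurable \<mu>"
  unfolding measurable_cong_sets[OF assms refl]
  by (intro borel_measurable_continuous_onI continuous_intros)+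

lemma norm_mult_poisson_weight2_le:
  fixes u v :: complex
  assumes "norm u \<le> C / (1 + (fst t)\<^sup>2)" "norm v \<le> D / (1 + (snd t)\<^sup>2)"
  shows "norm (u * v) \<le> (C * D) * poisson_weight2 t"
proof -
  have "norm u * norm v \<le> C / (1 + (fst t)\<^sup>2) * (D / (1 + (snd t)\<^sup>2))"
    using assms by (intro mult_mono) (auto intro: order_trans[OF norm_ge_zero])
  then show ?thesis by (simp add: norm_mult)
qed

text \<open>Each factor of the second product in the kernel equals \<open>2i/(1 + t^2)\<close>,
  which produces the weight. All dependence on \<open>z\<close> is thereby collected in one product
  of regularised kernels with base point \<open>-i\<close>.\<close>

lemma kernel2_eq:
  "kernel2 z t = - \<i> / 2 * (reg_cauchy (- \<i>) (fst z) (fst t) * reg_cauchy (- \<i>) (snd z) (snd t))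
     - \<i> * of_real (poisson_weight2 t)"
proof -
  have "1 / (of_real x - \<i>) - 1 / (of_real x + \<i>) = 2 * \<i> / of_real (1 + x\<^sup>2)" for x :: real
  proof -
    have "of_real x - \<i> \<noteq> 0" "of_real x + \<i> \<noteq> 0" by (auto simp: complex_eq_iff)
    moreover have "(of_real x - \<i>) * (of_real x + \<i>) = of_real (1 + x\<^sup>2)"
      by (simp add: algebra_simps power2_eq_square)
    ultimately show ?thesis by (simp add: divide_simps)
  qed
  then show ?thesis
    unfolding kernel2_def reg_cauchy_def by (simp add: power2_eq_square field_simps)
qed

text \<open>The Nevanlinna condition says that the mixed derivative of this integral in
  \<open>z1\<close> and \<open>cnj z2\<close> vanishes. It is undone one variable at a time by
  \<open>reg_cauchy_integral_eq_0\<close>, with base point \<open>i\<close> in the upper and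
  \<open>-i\<close> in the lower half-plane.\<close>

lemma mixed_reg_cauchy_integral_eq_0:
  assumes sets: "sets \<mu> = sets borel" and growth: "growth_cond2 \<mu>" and nev: "nevanlinna_cond2 \<mu>"
    and z: "0 < Im z1" "0 < Im z2"
  shows "(LINT t|\<mu>. reg_cauchy \<i> z1 (fst t) * reg_cauchy (- \<i>) (cnj z2) (snd t)) = 0"
proof -
  note [measurable] = fst_snd_borel_measurable[OF sets]
  have bound: "integrable \<mu> (\<lambda>t. norm (u t) / (1 + (v t)\<^sup>2))"
    if "{u', v} = {fst, snd :: real \<times> real \<Rightarrow> real}" and u: "\<And>t. norm (u t) \<le> C / (1 + (u' t)\<^sup>2)"
      and [measurable]: "u \<in> borel_measurable \<mu>" for u :: "real \<times> real \<Rightarrow> complex" and u' v C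
  proof -
    have uv: "u' = fst \<and> v = snd \<or> u' = snd \<and> v = fst"
      using that(1) by (metis doubleton_eq_iff)
    then have [measurable]: "v \<in> borel_measurable \<mu>" by auto
    have "norm (u t) / (1 + (v t)\<^sup>2) \<le> C * poisson_weight2 t" for t
      using divide_right_mono[OF u[of t], of "1 + (v t)\<^sup>2"] uv by (auto simp: mult.commute)
    then have "norm (norm (u t) / (1 + (v t)\<^sup>2)) \<le> C * poisson_weight2 t" for t
      unfolding real_norm_def by (subst abs_of_nonneg) (auto intro: add_nonneg_nonneg)
    then show ?thesis
      by (intro integrable_poisson_weight2_bound[OF sets growth, of _ C]) auto
  qed
  \<comment> \<open>Here the first variable has been treated while the second still carries its
    double pole. Since \<open>w\<close> is in the lower half-plane, \<open>cnj w\<close> is an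
    admissible \<open>z2\<close> in the Nevanlinna condition.\<close>
  have zero: "(LINT t|\<mu>. 1 / (of_real (snd t) - w)\<^sup>2 * reg_cauchy \<i> z1 (fst t)) = 0" if w: "Im w < 0" for w
  proof -
    let ?B = "\<lambda>t :: real \<times> real. 1 / (of_real (snd t) - w)\<^sup>2"
    have "Im w \<noteq> 0" "Im \<i> \<noteq> 0" using w by auto
    then obtain C where C: "\<And>t. norm (1 / (of_real t - w)\<^sup>2) \<le> C / (1 + t\<^sup>2)"
      using cauchy_kernel_bounds by metis
    have "(LINT t|\<mu>. reg_cauchy \<i> z1 (fst t) * ?B t) = 0"
    proof (rule reg_cauchy_integral_eq_0[where s = 1])
      show "integrable \<mu> (\<lambda>t. norm (?B t) / (1 + (fst t)\<^sup>2))"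
        by (rule bound[of snd fst]) (auto intro: C)
      fix v assume "0 < 1 * Im v"
      then show "(LINT t|\<mu>. 1 / (of_real (fst t) - v)\<^sup>2 * ?B t) = 0"
        using nev[unfolded nevanlinna_cond2_def upper_half_plane_def, THEN bspec, THEN bspec, of v "cnj w"] w
        by simp
    qed (use z in auto)
    then show ?thesis by (simp only: mult.commute)
  qed
  have "Im z1 \<noteq> 0" "Im \<i> \<noteq> 0" using z by auto
  then obtain C where C: "\<And>t. norm (reg_cauchy \<i> z1 t) \<le> C / (1 + t\<^sup>2)"
    using cauchy_kernel_bounds by metis
  have "(LINT t|\<mu>. reg_cauchy (- \<i>) (cnj z2) (snd t) * reg_cauchy \<i> z1 (fst t)) = 0"
  proof (rule reg_cauchy_integral_eq_0[where s = "-1"])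
    show "integrable \<mu> (\<lambda>t. norm (reg_cauchy \<i> z1 (fst t)) / (1 + (snd t)\<^sup>2))"
      by (rule bound[of fst snd]) (auto intro: C)
  qed (use z zero in auto)
  then show ?thesis by (simp only: mult.commute)
qed

text \<open>The first summand is a product of two Poisson kernels, hence non-negative; the second one
  integrates to \<open>0\<close> by \<open>mixed_reg_cauchy_integral_eq_0\<close>.\<close>

lemma Im_kernel2:
  assumes "0 < Im z1" "0 < Im z2"
  shows "Im (kernel2 (z1, z2) t) =
      Im z1 / (norm (of_real (fst t) - z1))\<^sup>2 * (Im z2 / (norm (of_real (snd t) - z2))\<^sup>2)
      - 1/2 * Re (reg_cauchy \<i> z1 (fst t) * reg_cauchy (- \<i>) (cnj z2) (snd t))"
proof -
  \<comment> \<open>In terms of the kernels \<open>A\<close> at \<open>z1\<close>, \<open>z2\<close>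
    and \<open>R\<close> at \<open>i\<close>, the claim is an algebraic identity that rests on
    \<open>Re (u v) - Re (u cnj v) = -2 Im u Im v\<close>, used once for \<open>A\<close> and once
    for \<open>R\<close>.\<close>
  define A where "A j = (if j then 1 / (of_real (fst t) - z1) else 1 / (of_real (snd t) - z2))" for j
  define R where "R j = (if j then 1 / (of_real (fst t) - \<i>) else 1 / (of_real (snd t) - \<i>))" for j
  have cA: "cnj (A True) = 1 / (of_real (fst t) - cnj z1)" "cnj (A False) = 1 / (of_real (snd t) - cnj z2)"
    by (simp_all add: A_def)
  have cR: "cnj (R True) = 1 / (of_real (fst t) - - \<i>)" "cnj (R False) = 1 / (of_real (snd t) - - \<i>)"
    by (simp_all add: R_def)
  have P: "Im (1 / (of_real x - z)) = Im z / (norm (of_real x - z))\<^sup>2" for x z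
    unfolding Im_divide cmod_power2 by simp
  have W: "1 / (1 + x\<^sup>2) = Im (1 / (of_real x - \<i>))" for x :: real
    unfolding Im_divide by (simp add: add.commute)
  have pw: "poisson_weight2 t = Im (R True) * Im (R False)"
    by (simp add: R_def W[symmetric])
  have rc: "reg_cauchy (- \<i>) z1 (fst t) = A True - cnj (R True)"
    "reg_cauchy (- \<i>) z2 (snd t) = A False - cnj (R False)"
    "reg_cauchy \<i> z1 (fst t) = A True - R True"
    "reg_cauchy (- \<i>) (cnj z2) (snd t) = cnj (A False) - cnj (R False)"
    unfolding reg_cauchy_def cA cR by (simp_all add: A_def R_def)
  have pk: "Im z1 / (norm (of_real (fst t) - z1))\<^sup>2 = Im (A True)"
    "Im z2 / (norm (of_real (snd t) - z2))\<^sup>2 = Im (A False)"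
    by (simp_all add: A_def P)
  show ?thesis
    unfolding kernel2_eq fst_conv snd_conv rc pk pw by (simp add: algebra_simps add_divide_distrib diff_divide_distrib)
qed

text \<open>The mixed product can be added to the integrand because its integral is
  \<open>0\<close>; what remains is a product of two Poisson kernels.\<close>

lemma Im_kernel2_integral_nonneg:
  assumes sets: "sets \<mu> = sets borel" and growth: "growth_cond2 \<mu>" and nev: "nevanlinna_cond2 \<mu>"
    and z: "0 < Im z1" "0 < Im z2"
  shows "0 \<le> Im (LINT t|\<mu>. kernel2 (z1, z2) t)"
proof -
  note [measurable] = fst_snd_borel_measurable[OF sets]
  have prod_int: "integrable \<mu> (\<lambda>t. reg_cauchy c w1 (fst t) * reg_cauchy d w2 (snd t))"
    if w: "Im w1 \<noteq> 0" "Im w2 \<noteq> 0" "Im c \<noteq> 0" "Im d \<noteq> 0" for w1 w2 c d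
  proof -
    obtain C where C: "\<And>t. norm (reg_cauchy c w1 t) \<le> C / (1 + t\<^sup>2)"
      using cauchy_kernel_bounds[OF w(1,3)] by metis
    obtain D where D: "\<And>t. norm (reg_cauchy d w2 t) \<le> D / (1 + t\<^sup>2)"
      using cauchy_kernel_bounds[OF w(2,4)] by metis
    show ?thesis
      using norm_mult_poisson_weight2_le[OF C D]
      by (intro integrable_poisson_weight2_bound[OF sets growth]) auto
  qed
  have K: "integrable \<mu> (kernel2 (z1, z2))"
    using z prod_int[of z1 z2 "- \<i>" "- \<i>"] integrable_poisson_weight2[OF sets growth]
    unfolding kernel2_eq by (intro Bochner_Integration.integrable_diff integrable_mult_right integrable_of_real) auto
  let ?M = "\<lambda>t. reg_cauchy \<i> z1 (fst t) * reg_cauchy (- \<i>) (cnj z2) (snd t)"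
  have M: "integrable \<mu> ?M" using z by (intro prod_int) auto
  have "Im (LINT t|\<mu>. kernel2 (z1, z2) t) = (LINT t|\<mu>. Im (kernel2 (z1, z2) t)) + 1/2 * Re (LINT t|\<mu>. ?M t)"
    using K mixed_reg_cauchy_integral_eq_0[OF assms] by (simp del: integral_Im add: integral_Im[symmetric])
  also have "\<dots> = (LINT t|\<mu>. Im (kernel2 (z1, z2) t) + 1/2 * Re (?M t))"
  proof -
    have "(LINT t|\<mu>. Im (k t)) + 1/2 * Re (LINT t|\<mu>. m t) = (LINT t|\<mu>. Im (k t) + 1/2 * Re (m t))"
      if "integrable \<mu> k" "integrable \<mu> m" for k m :: "real \<times> real \<Rightarrow> complex"
      using that by simp
    from this[OF K M] show ?thesis .
  qed
  also have "\<dots> \<ge> 0"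
    unfolding Im_kernel2[OF z] using z by (intro integral_nonneg_AE AE_I2) auto
  finally show ?thesis .
qed

text \<open>Joint differentiability is obtained directly: both factors are expanded in their own
  increment, and every term beyond the linear ones carries a product of two increments.\<close>

lemma reg_cauchy2_integral_has_derivative:
  assumes sets: "sets \<mu> = sets borel" and growth: "growth_cond2 \<mu>"
    and z: "Im z1 \<noteq> 0" "Im z2 \<noteq> 0" and c: "Im c \<noteq> 0"
  shows "\<exists>d1 d2. ((\<lambda>w. LINT t|\<mu>. reg_cauchy c (fst w) (fst t) * reg_cauchy c (snd w) (snd t))
      has_derivative (\<lambda>h. d1 * fst h + d2 * snd h)) (at (z1, z2))"
proof -
  note [measurable] = fst_snd_borel_measurable[OF sets]
  let ?A = "\<lambda>z t. 1 / (complex_of_real t - z)\<^sup>2"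
  let ?E = "\<lambda>z h t. 1 / (complex_of_real t - z) * (1 / (complex_of_real t - (z + h)))"
  let ?G = "\<lambda>z h t. 1 / (complex_of_real t - z)\<^sup>2 * (1 / (complex_of_real t - (z + h)))"
  obtain C where C: "C > 0" "\<And>t. norm (reg_cauchy c z1 t) \<le> C / (1 + t\<^sup>2)"
    "\<And>t. norm (?A z1 t) \<le> C / (1 + t\<^sup>2)"
    "\<And>t h. norm h \<le> \<bar>Im z1\<bar> / 2 \<Longrightarrow> norm (?E z1 h t) \<le> C / (1 + t\<^sup>2)"
    "\<And>t h. norm h \<le> \<bar>Im z1\<bar> / 2 \<Longrightarrow> norm (?G z1 h t) \<le> C / (1 + t\<^sup>2)"
    using cauchy_kernel_bounds[OF z(1) c] by metis
  obtain D where D: "D > 0" "\<And>t. norm (reg_cauchy c z2 t) \<le> D / (1 + t\<^sup>2)"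
    "\<And>t. norm (?A z2 t) \<le> D / (1 + t\<^sup>2)"
    "\<And>t h. norm h \<le> \<bar>Im z2\<bar> / 2 \<Longrightarrow> norm (?E z2 h t) \<le> D / (1 + t\<^sup>2)"
    "\<And>t h. norm h \<le> \<bar>Im z2\<bar> / 2 \<Longrightarrow> norm (?G z2 h t) \<le> D / (1 + t\<^sup>2)"
    using cauchy_kernel_bounds[OF z(2) c] by metis
  note int = integrable_poisson_weight2_bound[OF sets growth _ norm_mult_poisson_weight2_le]
  define J where "J = (LINT t|\<mu>. (C * D) * poisson_weight2 t)"
  have domint: "integrable \<mu> (\<lambda>t. (C * D) * poisson_weight2 t)"
    by (rule integrable_mult_right) (rule integrable_poisson_weight2[OF sets growth])
  have J: "J \<ge> 0" unfolding J_def using C(1) D(1) by (intro integral_nonneg_AE AE_I2) auto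
  have le_J: "norm (LINT t|\<mu>. u (fst t) * v (snd t)) \<le> J"
    if [measurable]: "u \<in> borel_measurable borel" "v \<in> borel_measurable borel"
      and "\<And>t. norm (u t) \<le> C / (1 + t\<^sup>2)" "\<And>t. norm (v t) \<le> D / (1 + t\<^sup>2)" for u v :: "real \<Rightarrow> complex"
    unfolding J_def using that(3,4)
    by (intro Bochner_Integration.integral_norm_bound_integral int domint norm_mult_poisson_weight2_le) auto
  let ?F = "\<lambda>w. LINT t|\<mu>. reg_cauchy c (fst w) (fst t) * reg_cauchy c (snd w) (snd t)"
  define d1 where "d1 = (LINT t|\<mu>. ?A z1 (fst t) * reg_cauchy c z2 (snd t))"
  define d2 where "d2 = (LINT t|\<mu>. reg_cauchy c z1 (fst t) * ?A z2 (snd t))"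
  define r where "r = min (\<bar>Im z1\<bar> / 2) (\<bar>Im z2\<bar> / 2)"
  have r: "r > 0" using z by (simp add: r_def)
  \<comment> \<open>The remainder consists of three integrals, two for the pure second-order terms
    and one for the mixed term. Each has norm at most \<open>J\<close>, hence the factor
    \<open>3\<close>.\<close>
  have key: "norm (?F (z1 + h1, z2 + h2) - ?F (z1, z2) - (d1 * h1 + d2 * h2)) \<le> 3 * J * (n * n)"
    if n: "norm h1 \<le> n" "norm h2 \<le> n" "n \<le> r" for h1 h2 n
  proof -
    have h: "norm h1 \<le> \<bar>Im z1\<bar> / 2" "norm h2 \<le> \<bar>Im z2\<bar> / 2" using n by (auto simp: r_def)
    let ?T1 = "LINT t|\<mu>. ?G z1 h1 (fst t) * reg_cauchy c z2 (snd t)"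
    let ?T2 = "LINT t|\<mu>. reg_cauchy c z1 (fst t) * ?G z2 h2 (snd t)"
    let ?T3 = "LINT t|\<mu>. ?E z1 h1 (fst t) * ?E z2 h2 (snd t)"
    have ints: "integrable \<mu> (\<lambda>t. reg_cauchy c z1 (fst t) * reg_cauchy c z2 (snd t))"
      "integrable \<mu> (\<lambda>t. ?A z1 (fst t) * reg_cauchy c z2 (snd t))"
      "integrable \<mu> (\<lambda>t. reg_cauchy c z1 (fst t) * ?A z2 (snd t))"
      "integrable \<mu> (\<lambda>t. ?G z1 h1 (fst t) * reg_cauchy c z2 (snd t))"
      "integrable \<mu> (\<lambda>t. reg_cauchy c z1 (fst t) * ?G z2 h2 (snd t))"
      "integrable \<mu> (\<lambda>t. ?E z1 h1 (fst t) * ?E z2 h2 (snd t))"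
      by (rule int, measurable, rule C, (rule h)?, rule D, (rule h)?)+
    have expand: "reg_cauchy c (z1 + h1) s * reg_cauchy c (z2 + h2) t =
        reg_cauchy c z1 s * reg_cauchy c z2 t + h1 * (?A z1 s * reg_cauchy c z2 t)
        + h2 * (reg_cauchy c z1 s * ?A z2 t) + h1 * h1 * (?G z1 h1 s * reg_cauchy c z2 t)
        + h2 * h2 * (reg_cauchy c z1 s * ?G z2 h2 t) + h1 * h2 * (?E z1 h1 s * ?E z2 h2 t)" for s t
    proof -
      \<comment> \<open>The splitting of \<open>E1\<close> and \<open>E2\<close> into derivative and
        remainder is used only in the terms linear in one increment; the mixed term is already
        quadratic and keeps \<open>E1\<close> and \<open>E2\<close> whole.\<close>
      have "(N1 + h1 * E1) * (N2 + h2 * E2) = N1 * N2 + h1 * (A1 * N2) + h2 * (N1 * A2)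
          + h1 * h1 * (G1 * N2) + h2 * h2 * (N1 * G2) + h1 * h2 * (E1 * E2)"
        if "E1 = A1 + h1 * G1" "E2 = A2 + h2 * G2" for N1 N2 E1 E2 A1 A2 G1 G2
      proof -
        have "(N1 + h1 * E1) * (N2 + h2 * E2) = N1 * N2 + h1 * (E1 * N2) + h2 * (N1 * E2) + h1 * h2 * (E1 * E2)"
          by (simp add: algebra_simps)
        also have "h1 * (E1 * N2) = h1 * (A1 * N2) + h1 * h1 * (G1 * N2)"
          unfolding that by (simp add: algebra_simps)
        also have "h2 * (N1 * E2) = h2 * (N1 * A2) + h2 * h2 * (N1 * G2)"
          unfolding that by (simp add: algebra_simps)
        finally show ?thesis by (simp add: add_ac)
      qed
      from this[OF reg_cauchy_add(2)[OF z(1) h(1), of s] reg_cauchy_add(2)[OF z(2) h(2), of t],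
        of "reg_cauchy c z1 s" "reg_cauchy c z2 t"]
      show ?thesis unfolding reg_cauchy_add(1)[OF z(1) h(1)] reg_cauchy_add(1)[OF z(2) h(2)] .
    qed
    have "?F (z1 + h1, z2 + h2) = ?F (z1, z2) + h1 * d1 + h2 * d2 + h1 * h1 * ?T1 + h2 * h2 * ?T2 + h1 * h2 * ?T3"
      unfolding d1_def d2_def fst_conv snd_conv expand
      by (simp only: ints Bochner_Integration.integral_add Bochner_Integration.integrable_add
          integrable_mult_right integral_mult_right_zero)
    then have eq: "?F (z1 + h1, z2 + h2) - ?F (z1, z2) - (d1 * h1 + d2 * h2)
        = h1 * h1 * ?T1 + h2 * h2 * ?T2 + h1 * h2 * ?T3"
      by (simp add: algebra_simps)
    have tri: "norm (h1 * h1 * T1 + h2 * h2 * T2 + h1 * h2 * T3) \<le> 3 * J * (n * n)"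
      if T: "norm T1 \<le> J" "norm T2 \<le> J" "norm T3 \<le> J" for T1 T2 T3
    proof -
      have "norm (a * b * T) \<le> n * n * J" if "norm a \<le> n" "norm b \<le> n" "norm T \<le> J" for a b T :: complex
        unfolding norm_mult using that by (intro mult_mono) (auto intro: order_trans[OF norm_ge_zero])
      from this[OF n(1) n(1) T(1)] this[OF n(2) n(2) T(2)] this[OF n(1) n(2) T(3)]
      have "norm (h1 * h1 * T1 + h2 * h2 * T2 + h1 * h2 * T3) \<le> n * n * J + n * n * J + n * n * J"
        by (intro norm_triangle_le add_mono)
      then show ?thesis by simp
    qed
    show ?thesis unfolding eq
      by (rule tri) (rule le_J, measurable, rule C, (rule h)?, rule D, (rule h)?)+
  qed
  have "(?F has_derivative (\<lambda>h. d1 * fst h + d2 * snd h)) (at (z1, z2))"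
    unfolding has_derivative_at_alt
  proof (intro conjI allI impI)
    show "bounded_linear (\<lambda>h. d1 * fst h + d2 * snd h)"
      by (intro bounded_linear_add bounded_linear_mult_right[THEN bounded_linear_compose]
          bounded_linear_fst bounded_linear_snd)
    fix e :: real assume e: "e > 0"
    define d where "d = min r (e / (3 * J + 1))"
    have "d > 0" unfolding d_def using r e J by (simp add: add_nonneg_pos)
    moreover have "norm (?F y - ?F (z1, z2) - (d1 * fst (y - (z1, z2)) + d2 * snd (y - (z1, z2))))
        \<le> e * norm (y - (z1, z2))" if y: "norm (y - (z1, z2)) < d" for y
    proof -
      define n where "n = norm (y - (z1, z2))"
      have nd: "n \<le> r" "n \<le> e / (3 * J + 1)" "0 \<le> n" using y by (auto simp: d_def n_def)
      obtain y1 y2 where y12: "y = (y1, y2)" by fastforce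
      have "norm (y1 - z1) \<le> n" "norm (y2 - z2) \<le> n"
        unfolding n_def y12 using norm_fst_le[of "y1 - z1" "y2 - z2"] norm_snd_le[of "y2 - z2" "y1 - z1"] by auto
      from key[OF this nd(1)]
      have "norm (?F y - ?F (z1, z2) - (d1 * fst (y - (z1, z2)) + d2 * snd (y - (z1, z2)))) \<le> (3 * J * n) * n"
        unfolding y12 by (simp add: mult.assoc)
      also have "3 * J * n \<le> e"
      proof -
        have "n * (3 * J + 1) \<le> e" using nd(2) J by (simp add: pos_le_divide_eq)
        then show ?thesis using nd(3) by (simp add: algebra_simps)
      qed
      then have "(3 * J * n) * n \<le> e * n" using nd(3) by (rule mult_right_mono)
      finally show ?thesis by (simp add: n_def)
    qed
    ultimately show "\<exists>d>0. \<forall>y. norm (y - (z1, z2)) < d \<longrightarrow>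
        norm (?F y - ?F (z1, z2) - (d1 * fst (y - (z1, z2)) + d2 * snd (y - (z1, z2)))) \<le> e * norm (y - (z1, z2))"
      by blast
  qed
  then show ?thesis by blast
qed

lemma ex_representing_measure2_iff:
  assumes sets: "sets \<mu> = sets borel"
  shows "(\<exists>q. herglotz_nevanlinna2 q \<and> representing_measure2 \<mu> q) \<longleftrightarrow> growth_cond2 \<mu> \<and> nevanlinna_cond2 \<mu>"
proof
  assume "\<exists>q. herglotz_nevanlinna2 q \<and> representing_measure2 \<mu> q"
  then show "growth_cond2 \<mu> \<and> nevanlinna_cond2 \<mu>" by (auto simp: representing_measure2_def)
next
  assume gn: "growth_cond2 \<mu> \<and> nevanlinna_cond2 \<mu>"
  then have growth: "growth_cond2 \<mu>" and nev: "nevanlinna_cond2 \<mu>" by auto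
  note [measurable] = fst_snd_borel_measurable[OF sets]
  define q where "q z = 1 / of_real (pi^2) * (LINT t|\<mu>. kernel2 z t)" for z
  let ?F = "\<lambda>w. LINT t|\<mu>. reg_cauchy (- \<i>) (fst w) (fst t) * reg_cauchy (- \<i>) (snd w) (snd t)"
  let ?W = "LINT t|\<mu>. complex_of_real (poisson_weight2 t)"
  let ?U = "upper_half_plane \<times> upper_half_plane"
  have "open ?U" unfolding upper_half_plane_def by (intro open_Times open_halfspace_Im_gt)
  \<comment> \<open>The integral of the kernel is split only for \<open>z\<close> in the domain,
    where both parts are integrable. The derivative is therefore transferred to \<open>q\<close> on
    the open set \<open>?U\<close>.\<close>
  have q_eq: "q z = 1 / of_real (pi^2) * (- \<i> / 2 * ?F z - \<i> * ?W)" if "z \<in> ?U" for z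
  proof -
    have z: "Im (fst z) \<noteq> 0" "Im (snd z) \<noteq> 0" "Im (- \<i>) \<noteq> 0"
      using that by (auto simp: upper_half_plane_def)
    obtain C where C: "\<And>t. norm (reg_cauchy (- \<i>) (fst z) t) \<le> C / (1 + t\<^sup>2)"
      using cauchy_kernel_bounds[OF z(1,3)] by metis
    obtain D where D: "\<And>t. norm (reg_cauchy (- \<i>) (snd z) t) \<le> D / (1 + t\<^sup>2)"
      using cauchy_kernel_bounds[OF z(2,3)] by metis
    have "integrable \<mu> (\<lambda>t. reg_cauchy (- \<i>) (fst z) (fst t) * reg_cauchy (- \<i>) (snd z) (snd t))"
      using norm_mult_poisson_weight2_le[OF C D]
      by (intro integrable_poisson_weight2_bound[OF sets growth]) auto
    moreover have "integrable \<mu> (\<lambda>t. complex_of_real (poisson_weight2 t))"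
      using integrable_poisson_weight2[OF sets growth] by (rule integrable_of_real)
    ultimately show ?thesis unfolding q_def kernel2_eq
      by (simp only: Bochner_Integration.integral_diff integrable_mult_right integral_mult_right_zero)
  qed
  have "holomorphic2_on q ?U" unfolding holomorphic2_on_def
  proof
    fix z assume zU: "z \<in> ?U"
    then have "Im (fst z) \<noteq> 0" "Im (snd z) \<noteq> 0" "Im (- \<i>) \<noteq> 0" by (auto simp: upper_half_plane_def)
    then obtain d1 d2 where "(?F has_derivative (\<lambda>h. d1 * fst h + d2 * snd h)) (at z)"
      using reg_cauchy2_integral_has_derivative[OF sets growth, of "fst z" "snd z" "- \<i>"] by auto
    from has_derivative_diff[OF has_derivative_mult_right[OF this, of "- \<i> / 2"]
        has_derivative_const[of "\<i> * ?W"]]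
    have "((\<lambda>z. 1 / of_real (pi^2) * (- \<i> / 2 * ?F z - \<i> * ?W)) has_derivative
        (\<lambda>h. 1 / of_real (pi^2) * (- \<i> / 2 * (d1 * fst h + d2 * snd h)))) (at z)"
      by (intro has_derivative_mult_right) (simp only: diff_zero)
    then have "(q has_derivative (\<lambda>h. 1 / of_real (pi^2) * (- \<i> / 2 * (d1 * fst h + d2 * snd h)))) (at z)"
      by (rule has_derivative_transform_within_open[OF _ \<open>open ?U\<close> zU]) (simp add: q_eq)
    then show "\<exists>c1 c2. (q has_derivative (\<lambda>h. c1 * fst h + c2 * snd h)) (at z)"
      by (intro exI[of _ "1 / of_real (pi^2) * (- \<i> / 2 * d1)"] exI[of _ "1 / of_real (pi^2) * (- \<i> / 2 * d2)"])
        (simp only: distrib_left mult.assoc)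
  qed
  moreover have "0 \<le> Im (q z)" if "z \<in> ?U" for z
  proof -
    obtain z1 z2 where z: "z = (z1, z2)" "0 < Im z1" "0 < Im z2"
      using \<open>z \<in> ?U\<close> unfolding upper_half_plane_def by auto
    have "q z = of_real (1 / pi^2) * (LINT t|\<mu>. kernel2 z t)" by (simp add: q_def)
    moreover have "Im (of_real r * w) = r * Im w" for r w by simp
    ultimately have "Im (q z) = 1 / pi^2 * Im (LINT t|\<mu>. kernel2 z t)" by simp
    then show ?thesis
      using Im_kernel2_integral_nonneg[OF sets growth nev z(2,3)] unfolding z(1) by simp
  qed
  ultimately have "herglotz_nevanlinna2 q" by (simp add: herglotz_nevanlinna2_def)
  moreover have "representing_measure2 \<mu> q"
    unfolding representing_measure2_def using sets growth nev
    by (auto simp: q_def intro!: exI[of _ "0::real"])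
  ultimately show "\<exists>q. herglotz_nevanlinna2 q \<and> representing_measure2 \<mu> q" by blast
qed

section \<open>Integrals with double poles\<close>

lemma integrable_poisson_weight1: "integrable lborel (\<lambda>x :: real. 1 / (1 + x\<^sup>2))"
  using integrable_inverse_1_plus_square
  by (simp add: set_integrable_def inverse_eq_divide)

lemma integral_lborel_FTC:
  fixes f F :: "real \<Rightarrow> complex"
  assumes "integrable lborel f" "\<And>x. isCont f x" "\<And>x. (F has_vector_derivative f x) (at x)"
    and "(F \<longlongrightarrow> A) at_bot" "(F \<longlongrightarrow> B) at_top"
  shows "(LINT x|lborel. f x) = B - A"
proof -
  have "(LBINT x=-\<infinity>..\<infinity>. f x) = B - A"
    by (rule interval_integral_FTC_integrable)
      (use assms in \<open>auto simp: ereal_tendsto_simps set_integrable_def\<close>)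
  then show ?thesis by (simp add: interval_lebesgue_integral_def set_lebesgue_integral_def)
qed

lemma filterlim_of_real_at_infinity_at_bot:
  "filterlim (of_real :: real \<Rightarrow> complex) at_infinity at_bot"
  using filterlim_of_real_at_infinity[where ?'a = complex]
  unfolding filterlim_at_infinity_conv_norm_at_top filterlim_at_bot_mirror by simp

lemma tendsto_inverse_of_real_minus:
  "((\<lambda>t. 1 / (complex_of_real t - z)) \<longlongrightarrow> 0) at_top"
  "((\<lambda>t. 1 / (complex_of_real t - z)) \<longlongrightarrow> 0) at_bot"
proof -
  have "((\<lambda>t. 1 / (complex_of_real t - z)) \<longlongrightarrow> 0) F" if "filterlim (of_real :: real \<Rightarrow> complex) at_infinity F" for F
  proof (rule tendsto_divide_0[OF tendsto_const])
    show "filterlim (\<lambda>t. complex_of_real t - z) at_infinity F"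
      using tendsto_add_filterlim_at_infinity'[OF that tendsto_const, of "- z"] by simp
  qed
  then show "((\<lambda>t. 1 / (complex_of_real t - z)) \<longlongrightarrow> 0) at_top" "((\<lambda>t. 1 / (complex_of_real t - z)) \<longlongrightarrow> 0) at_bot"
    using filterlim_of_real_at_infinity filterlim_of_real_at_infinity_at_bot by blast+
qed

lemma integrable_inverse_cauchy_power2:
  assumes "Im p \<noteq> 0"
  shows "integrable lborel (\<lambda>t. 1 / (complex_of_real t - p)\<^sup>2)"
proof -
  obtain C where C: "\<And>t. norm (1 / (of_real t - p)\<^sup>2) \<le> C / (1 + t\<^sup>2)"
    using cauchy_kernel_bounds[OF assms assms] by metis
  show ?thesis
  proof (rule Bochner_Integration.integrable_bound)
    show "integrable lborel (\<lambda>t :: real. C * (1 / (1 + t\<^sup>2)))"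
      by (rule integrable_mult_right) (rule integrable_poisson_weight1)
    show "AE t in lborel. norm (1 / (complex_of_real t - p)\<^sup>2) \<le> norm (C * (1 / (1 + t\<^sup>2)))"
      using C by (intro AE_I2) (metis abs_ge_self order_trans real_norm_def mult.right_neutral times_divide_eq_right)
  qed measurable
qed

text \<open>The antiderivative \<open>-1/(t - p)\<close> tends to \<open>0\<close> at both ends.
  This settles the Nevanlinna integral when one of the two poles is absent.\<close>

lemma integral_inverse_cauchy_power2:
  assumes "Im p \<noteq> 0"
  shows "(LINT t|lborel. 1 / (complex_of_real t - p)\<^sup>2) = 0"
proof -
  note ne = of_real_minus_neq_0[OF assms]
  let ?F = "\<lambda>t. - (1 / (complex_of_real t - p))"
  have "(LINT t|lborel. 1 / (complex_of_real t - p)\<^sup>2) = - 0 - (- 0)"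
  proof (rule integral_lborel_FTC[OF integrable_inverse_cauchy_power2[OF assms]])
    fix x :: real
    show "isCont (\<lambda>t. 1 / (complex_of_real t - p)\<^sup>2) x"
      using ne by (intro continuous_intros) auto
    have "((\<lambda>w. - (1 / (w - p))) has_field_derivative 1 / (of_real x - p)\<^sup>2) (at (of_real x))"
      using ne[of x] by (auto intro!: derivative_eq_intros simp: power2_eq_square)
    then show "(?F has_vector_derivative 1 / (of_real x - p)\<^sup>2) (at x)"
      by (rule has_vector_derivative_real_field)
  qed (intro tendsto_minus tendsto_inverse_of_real_minus)+
  then show ?thesis by simp
qed

text \<open>The logarithm itself diverges like \<open>ln |t|\<close>; once this is removed a limit
  exists, and in a difference of two logarithms the removed terms cancel. The limits at the two ends
  differ because \<open>t\<close> changes sign.\<close>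

lemma tendsto_Ln_of_real_minus:
  assumes c: "c = \<i> \<or> c = - \<i>"
  shows "((\<lambda>t. Ln (c * (complex_of_real t - p)) - of_real (ln \<bar>t\<bar>)) \<longlongrightarrow> Ln c) at_top"
    and "((\<lambda>t. Ln (c * (complex_of_real t - p)) - of_real (ln \<bar>t\<bar>)) \<longlongrightarrow> Ln (- c)) at_bot"
proof -
  have *: "((\<lambda>t. Ln (c * (complex_of_real t - p)) - of_real (ln \<bar>t\<bar>)) \<longlongrightarrow> Ln (s * c)) F"
    if lim: "filterlim (of_real :: real \<Rightarrow> complex) at_infinity F"
      and ev: "eventually (\<lambda>t. t \<noteq> 0 \<and> complex_of_real t = s * of_real \<bar>t\<bar>) F"
      and s: "s = 1 \<or> s = - 1" for s F
  proof -
    have "((\<lambda>t. p / complex_of_real t) \<longlongrightarrow> 0) F"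
      by (rule tendsto_divide_0[OF tendsto_const lim])
    then have lim1: "((\<lambda>t. s * c * (1 - p / complex_of_real t)) \<longlongrightarrow> s * c * (1 - 0)) F"
      by (intro tendsto_intros)
    have "s * c * (1 - 0) \<notin> \<real>\<^sub>\<le>\<^sub>0" using c s by (auto simp: complex_nonpos_Reals_iff)
    from tendsto_Ln[OF lim1 this]
    have lim2: "((\<lambda>t. Ln (s * c * (1 - p / complex_of_real t))) \<longlongrightarrow> Ln (s * c)) F" by simp
    have "eventually (\<lambda>t. s * c * (1 - p / complex_of_real t) \<noteq> 0) F"
      using tendsto_imp_eventually_ne[OF lim1, of 0] c s by auto
    with ev have "eventually (\<lambda>t. Ln (s * c * (1 - p / complex_of_real t))
        = Ln (c * (complex_of_real t - p)) - of_real (ln \<bar>t\<bar>)) F"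
    proof eventually_elim
      case (elim t)
      then have t: "\<bar>t\<bar> > 0" by simp
      have "c * (w - p) = w * (c * (1 - p / w))" if "w \<noteq> 0" for w
        using that by (simp add: field_simps)
      from this[of "of_real t"] t
      have "c * (complex_of_real t - p) = of_real t * (c * (1 - p / of_real t))"
        by simp
      \<comment> \<open>The positive factor \<open>|t|\<close> is split off instead of
        \<open>t\<close>, since \<open>Ln\<close> is additive for positive real factors. The sign
        \<open>s\<close> stays inside, where \<open>s c\<close> is \<open>i\<close> or
        \<open>-i\<close> and so off the branch cut.\<close>
      also have "\<dots> = of_real \<bar>t\<bar> * (s * c * (1 - p / of_real t))"
        using elim by (metis (no_types, lifting) mult.assoc mult.commute)
      finally have eq: "c * (complex_of_real t - p) = of_real \<bar>t\<bar> * (s * c * (1 - p / of_real t))" .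
      show ?case
        unfolding eq Ln_times_of_real[OF t elim(2)] Ln_of_real[OF t] by simp
    qed
    from Lim_transform_eventually[OF lim2 this] show ?thesis .
  qed
  have "eventually (\<lambda>t. t \<noteq> 0 \<and> complex_of_real t = 1 * of_real \<bar>t\<bar>) at_top"
    using eventually_gt_at_top[of 0] by eventually_elim auto
  from *[OF filterlim_of_real_at_infinity this]
  show "((\<lambda>t. Ln (c * (complex_of_real t - p)) - of_real (ln \<bar>t\<bar>)) \<longlongrightarrow> Ln c) at_top" by simp
  have "eventually (\<lambda>t. t \<noteq> 0 \<and> complex_of_real t = - 1 * of_real \<bar>t\<bar>) at_bot"
    using eventually_gt_at_bot[of 0] by eventually_elim auto
  from *[OF filterlim_of_real_at_infinity_at_bot this]
  show "((\<lambda>t. Ln (c * (complex_of_real t - p)) - of_real (ln \<bar>t\<bar>)) \<longlongrightarrow> Ln (- c)) at_bot" by simp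
qed

text \<open>If \<open>p = q\<close> both sides vanish, the right-hand side as a division by \<open>0\<close>.\<close>

lemma integral_inverse_two_double_poles:
  assumes p: "Im p \<noteq> 0" and q: "Im q \<noteq> 0"
  shows "(LINT t|lborel. 1 / ((complex_of_real t - p)\<^sup>2 * (complex_of_real t - q)\<^sup>2))
    = - 2 * pi * \<i> * of_real (sgn (Im p) - sgn (Im q)) / (p - q) ^ 3"
proof -
  note ne = of_real_minus_neq_0[OF p] of_real_minus_neq_0[OF q]
  let ?f = "\<lambda>t. 1 / ((complex_of_real t - p)\<^sup>2 * (complex_of_real t - q)\<^sup>2)"
  have cont: "isCont ?f x" for x
    using ne by (intro continuous_intros) auto
  have int: "integrable lborel ?f"
  proof (rule Bochner_Integration.integrable_bound)
    show "integrable lborel (\<lambda>t. 1 / (Im q)\<^sup>2 * norm (1 / (complex_of_real t - p)\<^sup>2))"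
      using integrable_inverse_cauchy_power2[OF p] by (intro integrable_mult_right integrable_norm)
    have "norm (?f t) \<le> 1 / (Im q)\<^sup>2 * norm (1 / (complex_of_real t - p)\<^sup>2)" for t
    proof -
      have "\<bar>Im q\<bar> \<le> norm (of_real t - q)" using abs_Im_le_cmod[of "of_real t - q"] by simp
      from power_mono[OF this, of 2] have le: "(Im q)\<^sup>2 \<le> (norm (of_real t - q))\<^sup>2" by simp
      have "norm (1 / (of_real t - q)\<^sup>2) \<le> 1 / (Im q)\<^sup>2"
        unfolding norm_divide norm_power norm_one using le q
        by (intro divide_left_mono mult_pos_pos) (auto intro: less_le_trans[OF _ le])
      from mult_right_mono[OF this, of "norm (1 / (complex_of_real t - p)\<^sup>2)"]
      show ?thesis by (simp add: norm_mult norm_divide mult.commute)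
    qed
    then show "AE t in lborel. norm (?f t) \<le> norm (1 / (Im q)\<^sup>2 * norm (1 / (complex_of_real t - p)\<^sup>2))"
      by (intro AE_I2) (metis abs_ge_self order_trans real_norm_def)
  qed measurable
  have D_inv: "((\<lambda>t. 1 / (t - w)) has_field_derivative - 1 / (of_real x - w)\<^sup>2) (at (of_real x))"
    if w: "Im w \<noteq> 0" for w :: complex and x :: real
    using of_real_minus_neq_0[OF w, of x] by (auto intro!: derivative_eq_intros simp: power2_eq_square)
  note inv0 = tendsto_inverse_of_real_minus
  show ?thesis
  proof (cases "p = q")
    case True
    let ?F = "\<lambda>t. - (1/3) * (1 / (complex_of_real t - p)) ^ 3"
    have "(LINT t|lborel. ?f t) = - (1/3) * 0 ^ 3 - (- (1/3) * 0 ^ 3)"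
    proof (rule integral_lborel_FTC[OF int cont])
      fix x :: real
      have "((\<lambda>w. - (1/3) * (1 / (w - p)) ^ 3) has_field_derivative ?f x) (at (of_real x))"
        unfolding True[symmetric]
        by (rule DERIV_cong[OF DERIV_cmult[OF DERIV_power[OF D_inv[OF p]]]]) (simp add: power_divide)
      then show "(?F has_vector_derivative ?f x) (at x)"
        by (rule has_vector_derivative_real_field)
    qed (intro tendsto_mult tendsto_const tendsto_power inv0)+
    then show ?thesis using True by simp
  next
    case False
    \<comment> \<open>The rotation by \<open>c w\<close> moves the line of all \<open>t - w\<close>
      with \<open>t\<close> real into the right half-plane, where the principal logarithm is
      holomorphic.\<close>
    define c where "c w = (if Im w > 0 then \<i> else - \<i>)" for w
    have c: "c w = \<i> \<or> c w = - \<i>" for w by (simp add: c_def)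
    define L where "L t = Ln (c p * (t - p)) - Ln (c q * (t - q))" for t
    \<comment> \<open>Partial fractions: with \<open>a = t - p\<close> and \<open>b = t - q\<close>
      one has \<open>1/a - 1/b = (p - q)/(a b)\<close>, so \<open>1/(a b)^2\<close> is
      \<open>(1/a - 1/b)^2 / (p - q)^2\<close>. Expanding the square and splitting
      \<open>1/(a b)\<close> once more gives this antiderivative.\<close>
    define G where "G t = 1 / (p - q)\<^sup>2 * (- (1 / (t - p)) - 1 / (t - q) - 2 / (p - q) * L t)" for t
    \<comment> \<open>The divergent parts \<open>ln |t|\<close> of the two logarithms
      cancel.\<close>
    have Ldiff: "((\<lambda>t. L (complex_of_real t)) \<longlongrightarrow> a - b) F"
      if "((\<lambda>t. Ln (c p * (complex_of_real t - p)) - of_real (ln \<bar>t\<bar>)) \<longlongrightarrow> a) F"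
        "((\<lambda>t. Ln (c q * (complex_of_real t - q)) - of_real (ln \<bar>t\<bar>)) \<longlongrightarrow> b) F" for a b F
      using tendsto_diff[OF that] by (simp add: L_def)
    have Gtop: "((\<lambda>t. G (complex_of_real t)) \<longlongrightarrow>
        1 / (p - q)\<^sup>2 * (- 0 - 0 - 2 / (p - q) * (Ln (c p) - Ln (c q)))) at_top"
      unfolding G_def using tendsto_Ln_of_real_minus(1)[OF c]
      by (intro tendsto_intros inv0 Ldiff)
    have Gbot: "((\<lambda>t. G (complex_of_real t)) \<longlongrightarrow>
        1 / (p - q)\<^sup>2 * (- 0 - 0 - 2 / (p - q) * (Ln (- c p) - Ln (- c q)))) at_bot"
      unfolding G_def using tendsto_Ln_of_real_minus(2)[OF c]
      by (intro tendsto_intros inv0 Ldiff)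
    have "(LINT t|lborel. ?f t) = 1 / (p - q)\<^sup>2 * (- 0 - 0 - 2 / (p - q) * (Ln (c p) - Ln (c q)))
        - 1 / (p - q)\<^sup>2 * (- 0 - 0 - 2 / (p - q) * (Ln (- c p) - Ln (- c q)))"
    proof (rule integral_lborel_FTC[OF int cont _ Gbot Gtop])
      fix x :: real
      have D_Ln: "((\<lambda>t. Ln (c w * (t - w))) has_field_derivative 1 / (of_real x - w)) (at (of_real x))"
        if w: "Im w \<noteq> 0" for w
      proof -
        have "0 < Re (c w * (of_real x - w))" using w by (auto simp: c_def)
        then have "c w * (of_real x - w) \<notin> \<real>\<^sub>\<le>\<^sub>0" by (auto simp: complex_nonpos_Reals_iff)
        then show ?thesis using of_real_minus_neq_0[OF w, of x] c[of w]
          by (auto intro!: derivative_eq_intros simp: divide_simps)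
      qed
      have "(G has_field_derivative 1 / (p - q)\<^sup>2 * (- (- 1 / (of_real x - p)\<^sup>2) - (- 1 / (of_real x - q)\<^sup>2)
          - 2 / (p - q) * (1 / (of_real x - p) - 1 / (of_real x - q)))) (at (of_real x))"
        unfolding G_def L_def
        by (intro DERIV_cmult DERIV_diff DERIV_minus D_Ln D_inv p q)
      moreover have "1 / (p - q)\<^sup>2 * (- (- 1 / a\<^sup>2) - (- 1 / b\<^sup>2) - 2 / (p - q) * (1 / a - 1 / b)) = 1 / (a\<^sup>2 * b\<^sup>2)"
        if ab: "a \<noteq> 0" "b \<noteq> 0" and eq: "p - q = b - a" for a b
      proof -
        have d: "p - q \<noteq> 0" using False by simp
        have s: "1 / a - 1 / b = (p - q) / (a * b)" unfolding eq using ab by (simp add: field_simps)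
        have cancel: "m / u * (u / v) = m / v" if "u \<noteq> 0" for m u v :: complex using that by simp
        have "2 / (p - q) * (1 / a - 1 / b) = 2 / (a * b)" unfolding s by (rule cancel[OF d])
        moreover have "- (- 1 / a\<^sup>2) - (- 1 / b\<^sup>2) - 2 / (a * b) = (1 / a - 1 / b)\<^sup>2"
          by (simp add: power2_diff power_divide)
        ultimately show ?thesis
          unfolding s using d by (simp only:) (simp add: power_divide power_mult_distrib)
      qed
      from this[OF ne(1)[of x] ne(2)[of x]]
      have "1 / (p - q)\<^sup>2 * (- (- 1 / (of_real x - p)\<^sup>2) - (- 1 / (of_real x - q)\<^sup>2)
          - 2 / (p - q) * (1 / (of_real x - p) - 1 / (of_real x - q))) = ?f x" by simp
      ultimately have "(G has_field_derivative ?f x) (at (of_real x))" by simp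
      then show "((\<lambda>t. G (complex_of_real t)) has_vector_derivative ?f x) (at x)"
        by (rule has_vector_derivative_real_field)
    qed
    also have "\<dots> = - 2 / (p - q) ^ 3 * (Ln (c p) - Ln (- c p) - (Ln (c q) - Ln (- c q)))"
    proof -
      have "1 / u\<^sup>2 * (- 0 - 0 - 2 / u * (x - y)) - 1 / u\<^sup>2 * (- 0 - 0 - 2 / u * (x' - y'))
        = - 2 / u ^ 3 * (x - x' - (y - y'))" if "u \<noteq> 0" for u x y x' y' :: complex
        using that by (simp add: field_simps eval_nat_numeral)
      then show ?thesis using False by simp
    qed
    also have "\<dots> = - 2 / (p - q) ^ 3 * (pi * \<i> * sgn (Im p) - pi * \<i> * sgn (Im q))"
    proof -
      \<comment> \<open>This is the total change of the rotated logarithm along the real line. It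
        depends only on the half-plane of the pole, so two poles on the same side contribute
        \<open>0\<close>.\<close>
      have "Ln (c w) - Ln (- c w) = pi * \<i> * sgn (Im w)" if "Im w \<noteq> 0" for w
        using that by (auto simp: c_def sgn_if)
      from this[OF p] this[OF q] show ?thesis by (simp only:)
    qed
    finally show ?thesis by (simp add: algebra_simps diff_divide_distrib)
  qed
qed

section \<open>Growth of line measures\<close>

lemma measurable_line_map:
  assumes "sets \<mu>1 = sets borel"
  shows "(\<lambda>(t1, t2). (\<alpha> * t1 + \<beta> * t2, \<gamma> * t1 + \<delta> * t2) :: real \<times> real) \<in> \<mu>1 \<Otimes>\<^sub>M lborel \<rightarrow>\<^sub>M borel"
proof -
  have "(\<lambda>(t1, t2). (\<alpha> * t1 + \<beta> * t2, \<gamma> * t1 + \<delta> * t2) :: real \<times> real) \<in> borel \<Otimes>\<^sub>M borel \<rightarrow>\<^sub>M borel"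
    unfolding borel_prod
    by (intro borel_measurable_continuous_onI) (auto simp: case_prod_beta intro!: continuous_intros)
  also have "borel \<Otimes>\<^sub>M borel \<rightarrow>\<^sub>M borel = (\<mu>1 \<Otimes>\<^sub>M lborel \<rightarrow>\<^sub>M borel :: (real \<times> real \<Rightarrow> real \<times> real) set)"
    by (intro measurable_cong_sets sets_pair_measure_cong) (auto simp: assms)
  finally show ?thesis .
qed

text \<open>Evaluating the product measure by iterated integration relies on sigma-finiteness of the
  inner factor \<open>lborel\<close>, so the identity holds for every Borel measure
  \<open>\<mu>1\<close>.\<close>

lemma line_measure_eq_distr:
  assumes "sets \<mu>1 = sets borel"
  shows "line_measure \<alpha> \<beta> \<gamma> \<delta> \<mu>1 =
    distr (\<mu>1 \<Otimes>\<^sub>M lborel) borel (\<lambda>(t1, t2). (\<alpha> * t1 + \<beta> * t2, \<gamma> * t1 + \<delta> * t2))"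
    (is "?L = distr ?P _ ?T")
proof (rule measure_eqI)
  fix U assume "U \<in> sets ?L"
  then have U: "U \<in> sets borel" by simp
  note T = measurable_line_map[OF assms, of \<alpha> \<beta> \<gamma> \<delta>]
  have "emeasure (distr ?P borel ?T) U = emeasure ?P (?T -` U \<inter> space ?P)"
    by (rule emeasure_distr[OF T U])
  also have "\<dots> = (\<integral>\<^sup>+ x. \<integral>\<^sup>+ y. indicator (?T -` U \<inter> space ?P) (x, y) \<partial>lborel \<partial>\<mu>1)"
    by (intro lborel.emeasure_pair_measure measurable_sets[OF T U])
  also have "\<dots> = (\<integral>\<^sup>+ x. \<integral>\<^sup>+ y. indicator U (?T (x, y)) \<partial>lborel \<partial>\<mu>1)"
    by (intro nn_integral_cong) (auto simp: indicator_def space_pair_measure)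
  finally show "emeasure ?L U = emeasure (distr ?P borel ?T) U"
    unfolding emeasure_line_measure[OF assms U] by simp
qed simp

lemma nn_integral_line_measure:
  assumes "sets \<mu>1 = sets borel" and f: "f \<in> borel_measurable borel"
  shows "(\<integral>\<^sup>+ t. f t \<partial>line_measure \<alpha> \<beta> \<gamma> \<delta> \<mu>1) =
    (\<integral>\<^sup>+ t1. \<integral>\<^sup>+ t2. f (\<alpha> * t1 + \<beta> * t2, \<gamma> * t1 + \<delta> * t2) \<partial>lborel \<partial>\<mu>1)"
proof -
  note T = measurable_line_map[OF assms(1), of \<alpha> \<beta> \<gamma> \<delta>]
  show ?thesis
    unfolding line_measure_eq_distr[OF assms(1)]
    by (subst nn_integral_distr[OF T], use f in simp, subst lborel.nn_integral_fst[symmetric])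
      (use measurable_compose[OF T f] in auto)
qed

text \<open>Fubini's theorem for complex integrands uses sigma-finiteness of both factors; for
  \<open>\<mu>1\<close> it will be deduced from the growth condition.\<close>

lemma integral_line_measure:
  fixes f :: "real \<times> real \<Rightarrow> complex"
  assumes "sets \<mu>1 = sets borel" and "sigma_finite_measure \<mu>1"
    and f: "integrable (line_measure \<alpha> \<beta> \<gamma> \<delta> \<mu>1) f"
  shows "(LINT t|line_measure \<alpha> \<beta> \<gamma> \<delta> \<mu>1. f t) =
    (LINT t1|\<mu>1. LINT t2|lborel. f (\<alpha> * t1 + \<beta> * t2, \<gamma> * t1 + \<delta> * t2))"
proof -
  interpret sigma_finite_measure \<mu>1 by fact
  interpret pair_sigma_finite \<mu>1 "lborel :: real measure" ..
  note T = measurable_line_map[OF assms(1), of \<alpha> \<beta> \<gamma> \<delta>]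
  have f': "f \<in> borel_measurable borel"
    using borel_measurable_integrable[OF f] by (simp add: measurable_cong_sets[OF sets_line_measure refl])
  have "integrable (\<mu>1 \<Otimes>\<^sub>M lborel) (\<lambda>x. f (case x of (t1, t2) \<Rightarrow> (\<alpha> * t1 + \<beta> * t2, \<gamma> * t1 + \<delta> * t2)))"
    using f unfolding line_measure_eq_distr[OF assms(1)] by (subst (asm) integrable_distr_eq[OF T f'])
  from integral_fst'[OF this] show ?thesis
    unfolding line_measure_eq_distr[OF assms(1)] integral_distr[OF T f'] by simp
qed

section \<open>Two-sided bounds for the inner growth integral\<close>

lemma nn_integral_poisson_affine:
  fixes a b :: real
  assumes "b \<noteq> 0"
  shows "(\<integral>\<^sup>+ t. ennreal (1 / (1 + (a + b * t)\<^sup>2)) \<partial>lborel) = (\<integral>\<^sup>+ t. ennreal (1 / (1 + t\<^sup>2)) \<partial>lborel) / ennreal \<bar>b\<bar>"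
    and "(\<integral>\<^sup>+ t. ennreal (1 / (1 + t\<^sup>2)) \<partial>lborel) / ennreal \<bar>b\<bar> < \<infinity>"
proof -
  have "(\<integral>\<^sup>+ t. ennreal (1 / (1 + t\<^sup>2)) \<partial>lborel)
      = ennreal \<bar>b\<bar> * (\<integral>\<^sup>+ t. ennreal (1 / (1 + (a + b * t)\<^sup>2)) \<partial>lborel)"
    by (rule nn_integral_real_affine[OF _ assms]) measurable
  then show "(\<integral>\<^sup>+ t. ennreal (1 / (1 + (a + b * t)\<^sup>2)) \<partial>lborel) = (\<integral>\<^sup>+ t. ennreal (1 / (1 + t\<^sup>2)) \<partial>lborel) / ennreal \<bar>b\<bar>"
    using assms ennreal_mult_divide_eq[of "ennreal \<bar>b\<bar>" "\<integral>\<^sup>+ t. ennreal (1 / (1 + (a + b * t)\<^sup>2)) \<partial>lborel"]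
    by (simp only: mult.commute[of "ennreal \<bar>b\<bar>"]) simp
  have "(\<integral>\<^sup>+ t. ennreal (1 / (1 + t\<^sup>2)) \<partial>lborel) < \<infinity>"
    using integrable_poisson_weight1 by (simp add: integrable_iff_bounded add_nonneg_nonneg)
  then show "(\<integral>\<^sup>+ t. ennreal (1 / (1 + t\<^sup>2)) \<partial>lborel) / ennreal \<bar>b\<bar> < \<infinity>"
    using assms by (simp add: ennreal_divide_eq_top_iff less_top[symmetric])
qed

lemma nn_integral_finite_cmult_bound:
  fixes f :: "'a \<Rightarrow> ennreal"
  assumes "g \<in> borel_measurable M" "\<And>x. f x \<le> ennreal C * g x" "(\<integral>\<^sup>+ x. g x \<partial>M) < \<infinity>"
  shows "(\<integral>\<^sup>+ x. f x \<partial>M) < \<infinity>"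
proof -
  have "(\<integral>\<^sup>+ x. f x \<partial>M) \<le> (\<integral>\<^sup>+ x. ennreal C * g x \<partial>M)"
    by (rule nn_integral_mono) (rule assms)
  also have "\<dots> = ennreal C * (\<integral>\<^sup>+ x. g x \<partial>M)"
    by (rule nn_integral_cmult) (rule assms)
  also have "\<dots> < \<infinity>" using assms(3) by (simp add: ennreal_mult_less_top)
  finally show ?thesis .
qed

text \<open>This is applied with \<open>(\<alpha>\<delta> - \<beta>\<gamma>) t1 = \<delta> x - \<beta> y\<close>, where \<open>x = \<alpha> t1 + \<beta> t2\<close> and \<open>y = \<gamma> t1 + \<delta> t2\<close>.\<close>

lemma power2_diff_le: "(u - v)\<^sup>2 \<le> 2 * u\<^sup>2 + 2 * v\<^sup>2" for u v :: real
  using zero_le_power2[of "u + v"] by (simp add: power2_eq_square algebra_simps)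

text \<open>The square of \<open>\<delta> x - \<beta> y\<close> is controlled by \<open>x^2\<close>
  and \<open>y^2\<close>, so one of the two factors can be traded for
  \<open>1/(1 + (\<delta> x - \<beta> y)^2)\<close>. The conditionals remove the summand that would
  be constant in the inner variable and hence not integrable.\<close>

lemma weight_upper_bound:
  fixes x y \<beta> \<delta> :: real
  assumes "\<beta> \<noteq> 0 \<or> \<delta> \<noteq> 0"
  shows "1 / ((1 + x\<^sup>2) * (1 + y\<^sup>2)) \<le>
    (1 + 2 * \<delta>\<^sup>2 + 2 * \<beta>\<^sup>2) * (1 / (1 + (\<delta> * x - \<beta> * y)\<^sup>2)) *
      ((if \<beta> = 0 then 0 else 1 / (1 + x\<^sup>2)) + (if \<delta> = 0 then 0 else 1 / (1 + y\<^sup>2)))"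
proof -
  \<comment> \<open>This is the sum in the claim multiplied by \<open>(1 + x^2)(1 + y^2)\<close>,
    hence the exchanged roles of \<open>x\<close> and \<open>y\<close>.\<close>
  let ?S = "(if \<beta> = 0 then 0 else 1 + y\<^sup>2) + (if \<delta> = 0 then 0 else 1 + x\<^sup>2)"
  have pos: "1 + x\<^sup>2 > 0" "1 + y\<^sup>2 > 0" "1 + (\<delta> * x - \<beta> * y)\<^sup>2 > 0" by (auto simp: add_pos_nonneg)
  have "(\<delta> * x - \<beta> * y)\<^sup>2 \<le> 2 * \<delta>\<^sup>2 * x\<^sup>2 + 2 * \<beta>\<^sup>2 * y\<^sup>2"
    using power2_diff_le[of "\<delta> * x" "\<beta> * y"] by (simp add: power_mult_distrib)
  also have "\<dots> \<le> (1 + 2 * \<delta>\<^sup>2 + 2 * \<beta>\<^sup>2) * ?S - 1"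
  proof -
    have "0 \<le> \<delta>\<^sup>2" "0 \<le> \<beta>\<^sup>2" "0 \<le> x\<^sup>2" "0 \<le> y\<^sup>2" "0 \<le> \<delta>\<^sup>2 * x\<^sup>2" "0 \<le> \<beta>\<^sup>2 * y\<^sup>2" "0 \<le> \<delta>\<^sup>2 * y\<^sup>2" "0 \<le> \<beta>\<^sup>2 * x\<^sup>2"
      by auto
    then show ?thesis using assms by (auto simp: algebra_simps)
  qed
  finally have "1 + (\<delta> * x - \<beta> * y)\<^sup>2 \<le> (1 + 2 * \<delta>\<^sup>2 + 2 * \<beta>\<^sup>2) * ?S" by simp
  then have "1 / ((1 + x\<^sup>2) * (1 + y\<^sup>2)) \<le>
      (1 + 2 * \<delta>\<^sup>2 + 2 * \<beta>\<^sup>2) * ?S / (1 + (\<delta> * x - \<beta> * y)\<^sup>2) / ((1 + x\<^sup>2) * (1 + y\<^sup>2))"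
    using pos by (intro divide_right_mono) (auto simp: pos_le_divide_eq)
  also have "?S = ((if \<beta> = 0 then 0 else 1 / (1 + x\<^sup>2)) + (if \<delta> = 0 then 0 else 1 / (1 + y\<^sup>2))) * ((1 + x\<^sup>2) * (1 + y\<^sup>2))"
  proof -
    have "1 / X * (X * Y) = Y" "1 / Y * (X * Y) = X" if "X > 0" "Y > 0" for X Y :: real
      using that by auto
    from this[OF pos(1,2)] show ?thesis by (simp only: distrib_right split: if_splits) simp
  qed
  also have "(1 + 2 * \<delta>\<^sup>2 + 2 * \<beta>\<^sup>2) * (R * ((1 + x\<^sup>2) * (1 + y\<^sup>2))) / (1 + (\<delta> * x - \<beta> * y)\<^sup>2) / ((1 + x\<^sup>2) * (1 + y\<^sup>2))
      = (1 + 2 * \<delta>\<^sup>2 + 2 * \<beta>\<^sup>2) * (1 / (1 + (\<delta> * x - \<beta> * y)\<^sup>2)) * R" for R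
    using pos by simp
  finally show ?thesis .
qed

text \<open>The traded factor is independent of \<open>t2\<close> and leaves the integral. An affine
  substitution shows that the remaining integrals do not depend on \<open>t1\<close>.\<close>

lemma inner_weight_upper_bound:
  fixes \<alpha> \<beta> \<gamma> \<delta> :: real
  assumes "\<beta> \<noteq> 0 \<or> \<delta> \<noteq> 0"
  obtains K where "K < \<infinity>"
    "\<And>t1. (\<integral>\<^sup>+ t2. ennreal (1 / ((1 + (\<alpha> * t1 + \<beta> * t2)\<^sup>2) * (1 + (\<gamma> * t1 + \<delta> * t2)\<^sup>2))) \<partial>lborel)
      \<le> K * ennreal (1 / (1 + ((\<alpha> * \<delta> - \<beta> * \<gamma>) * t1)\<^sup>2))"
proof -
  let ?I = "\<integral>\<^sup>+ t. ennreal (1 / (1 + t\<^sup>2)) \<partial>lborel"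
  define C where "C = 1 + 2 * \<delta>\<^sup>2 + 2 * \<beta>\<^sup>2"
  have C: "C \<ge> 0" by (simp add: C_def)
  define K where "K = ennreal C * ((if \<beta> = 0 then 0 else ?I / ennreal \<bar>\<beta>\<bar>) + (if \<delta> = 0 then 0 else ?I / ennreal \<bar>\<delta>\<bar>))"
  show ?thesis
  proof (rule that[of K])
    show "K < \<infinity>" unfolding K_def using nn_integral_poisson_affine(2)
      by (auto simp: ennreal_mult_less_top)
    fix t1 :: real
    let ?x = "\<lambda>t2. \<alpha> * t1 + \<beta> * t2" and ?y = "\<lambda>t2. \<gamma> * t1 + \<delta> * t2"
    let ?u = "\<lambda>t2. ennreal (if \<beta> = 0 then 0 else 1 / (1 + (?x t2)\<^sup>2))"
    let ?v = "\<lambda>t2. ennreal (if \<delta> = 0 then 0 else 1 / (1 + (?y t2)\<^sup>2))"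
    let ?w = "1 / (1 + ((\<alpha> * \<delta> - \<beta> * \<gamma>) * t1)\<^sup>2)"
    have w: "?w \<ge> 0" by simp
    have D: "\<delta> * ?x t2 - \<beta> * ?y t2 = (\<alpha> * \<delta> - \<beta> * \<gamma>) * t1" for t2 by (simp add: algebra_simps)
    have "(\<integral>\<^sup>+ t2. ennreal (1 / ((1 + (?x t2)\<^sup>2) * (1 + (?y t2)\<^sup>2))) \<partial>lborel)
        \<le> (\<integral>\<^sup>+ t2. ennreal (C * ?w) * (?u t2 + ?v t2) \<partial>lborel)"
    proof (rule nn_integral_mono)
      fix t2
      have "ennreal (1 / ((1 + (?x t2)\<^sup>2) * (1 + (?y t2)\<^sup>2))) \<le> ennreal ((C * ?w) *
         ((if \<beta> = 0 then 0 else 1 / (1 + (?x t2)\<^sup>2)) + (if \<delta> = 0 then 0 else 1 / (1 + (?y t2)\<^sup>2))))"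
        using weight_upper_bound[OF assms, of "?x t2" "?y t2"] unfolding D C_def by (rule ennreal_leI)
      also have "\<dots> = ennreal (C * ?w) * (?u t2 + ?v t2)"
        using C w by (subst ennreal_mult) (auto simp: ennreal_plus)
      finally show "ennreal (1 / ((1 + (?x t2)\<^sup>2) * (1 + (?y t2)\<^sup>2))) \<le> ennreal (C * ?w) * (?u t2 + ?v t2)" .
    qed
    also have "\<dots> = ennreal (C * ?w) * ((\<integral>\<^sup>+ t2. ?u t2 \<partial>lborel) + (\<integral>\<^sup>+ t2. ?v t2 \<partial>lborel))"
      by (simp add: nn_integral_cmult nn_integral_add)
    also have "(\<integral>\<^sup>+ t2. ?u t2 \<partial>lborel) = (if \<beta> = 0 then 0 else ?I / ennreal \<bar>\<beta>\<bar>)"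
      using nn_integral_poisson_affine(1)[of \<beta> "\<alpha> * t1"] by simp
    also have "(\<integral>\<^sup>+ t2. ?v t2 \<partial>lborel) = (if \<delta> = 0 then 0 else ?I / ennreal \<bar>\<delta>\<bar>)"
      using nn_integral_poisson_affine(1)[of \<delta> "\<gamma> * t1"] by simp
    also have "ennreal (C * ?w) = ennreal C * ennreal ?w" by (rule ennreal_mult[OF C w])
    finally show "(\<integral>\<^sup>+ t2. ennreal (1 / ((1 + (?x t2)\<^sup>2) * (1 + (?y t2)\<^sup>2))) \<partial>lborel) \<le> K * ennreal ?w"
      unfolding K_def by (simp only: mult_ac)
  qed
qed

text \<open>The inner integral is restricted to those \<open>t2\<close> with
  \<open>\<alpha> t1 + \<beta> t2\<close> in the unit interval. They form a set of length
  \<open>1/|\<beta>|\<close>, on which the second coordinate grows at most linearly in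
  \<open>(\<alpha>\<delta> - \<beta>\<gamma>) t1\<close>.\<close>

lemma inner_weight_lower_bound:
  fixes \<alpha> \<beta> \<gamma> \<delta> :: real
  assumes \<beta>: "\<beta> \<noteq> 0"
  obtains k where
    "\<And>t1. ennreal (1 / (1 + ((\<alpha> * \<delta> - \<beta> * \<gamma>) * t1)\<^sup>2)) \<le> ennreal k *
      (\<integral>\<^sup>+ t2. ennreal (1 / ((1 + (\<alpha> * t1 + \<beta> * t2)\<^sup>2) * (1 + (\<gamma> * t1 + \<delta> * t2)\<^sup>2))) \<partial>lborel)"
proof -
  \<comment> \<open>On the restricted set, \<open>2\<close> bounds \<open>1 + x^2\<close>, and the
    other factor bounds \<open>1 + y^2\<close> relative to \<open>1 + ?d^2\<close>.\<close>
  define C where "C = 2 * (1 + 2 * (\<delta>\<^sup>2 + 1) / \<beta>\<^sup>2)"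
  have C: "C > 0" unfolding C_def by (intro mult_pos_pos add_pos_nonneg) auto
  show ?thesis
  proof (rule that[of "C * \<bar>\<beta>\<bar>"])
    fix t1 :: real
    let ?d = "(\<alpha> * \<delta> - \<beta> * \<gamma>) * t1"
    let ?x = "\<lambda>t2. \<alpha> * t1 + \<beta> * t2" and ?y = "\<lambda>t2. \<gamma> * t1 + \<delta> * t2"
    have pointwise: "1 / (1 + ?d\<^sup>2) \<le> C * (1 / ((1 + (?x t2)\<^sup>2) * (1 + (?y t2)\<^sup>2)))"
      if x: "?x t2 \<in> {0..1}" for t2
    proof -
      have x2: "(?x t2)\<^sup>2 \<le> 1" using x by (simp add: power_le_one)
      have "(\<beta> * ?y t2)\<^sup>2 = (\<delta> * ?x t2 - ?d)\<^sup>2" by (simp add: algebra_simps)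
      also have "\<dots> \<le> 2 * (\<delta>\<^sup>2 * (?x t2)\<^sup>2) + 2 * ?d\<^sup>2"
        unfolding power_mult_distrib[of \<delta>, symmetric] by (rule power2_diff_le)
      also have "\<dots> \<le> 2 * \<delta>\<^sup>2 + 2 * ?d\<^sup>2"
        using mult_left_le[OF x2, of "\<delta>\<^sup>2"] by simp
      also have "\<dots> \<le> 2 * (\<delta>\<^sup>2 + 1) * (1 + ?d\<^sup>2)"
        by (simp add: distrib_left distrib_right)
      finally have "(?y t2)\<^sup>2 \<le> 2 * (\<delta>\<^sup>2 + 1) / \<beta>\<^sup>2 * (1 + ?d\<^sup>2)"
        using \<beta> by (simp add: power_mult_distrib pos_le_divide_eq mult.commute)
      then have y: "1 + (?y t2)\<^sup>2 \<le> (1 + 2 * (\<delta>\<^sup>2 + 1) / \<beta>\<^sup>2) * (1 + ?d\<^sup>2)"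
        using zero_le_power2[of ?d] unfolding distrib_right mult_1 by linarith
      have "(1 + (?x t2)\<^sup>2) * (1 + (?y t2)\<^sup>2) \<le> 2 * ((1 + 2 * (\<delta>\<^sup>2 + 1) / \<beta>\<^sup>2) * (1 + ?d\<^sup>2))"
        using x2 y by (intro mult_mono) auto
      also have "\<dots> = C * (1 + ?d\<^sup>2)" by (simp add: C_def)
      finally have le: "(1 + (?x t2)\<^sup>2) * (1 + (?y t2)\<^sup>2) \<le> C * (1 + ?d\<^sup>2)" .
      have pos: "0 < (1 + (?x t2)\<^sup>2) * (1 + (?y t2)\<^sup>2)" "0 < 1 + ?d\<^sup>2" by (intro mult_pos_pos add_pos_nonneg; simp)+
      have "1 / (1 + ?d\<^sup>2) = C / (C * (1 + ?d\<^sup>2))" using C by simp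
      also have "\<dots> \<le> C / ((1 + (?x t2)\<^sup>2) * (1 + (?y t2)\<^sup>2))"
        using le C pos by (intro divide_left_mono mult_pos_pos) (auto intro: add_pos_nonneg)
      finally show ?thesis by simp
    qed
    \<comment> \<open>The number \<open>1\<close> is written as the length of the unit interval,
      which becomes \<open>|\<beta>|\<close> times the length of the restricted set.\<close>
    have "ennreal (1 / (1 + ?d\<^sup>2)) = ennreal (1 / (1 + ?d\<^sup>2)) * (\<integral>\<^sup>+ t. indicator {0..1 :: real} t \<partial>lborel)"
      by simp
    also have "(\<integral>\<^sup>+ t. indicator {0..1 :: real} t \<partial>lborel)
        = ennreal \<bar>\<beta>\<bar> * (\<integral>\<^sup>+ t2. indicator {0..1} (?x t2) \<partial>lborel)"
      by (rule nn_integral_real_affine[OF _ \<beta>]) measurable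
    also have "ennreal (1 / (1 + ?d\<^sup>2)) * (ennreal \<bar>\<beta>\<bar> * (\<integral>\<^sup>+ t2. indicator {0..1} (?x t2) \<partial>lborel))
        = ennreal \<bar>\<beta>\<bar> * (\<integral>\<^sup>+ t2. ennreal (1 / (1 + ?d\<^sup>2)) * indicator {0..1} (?x t2) \<partial>lborel)"
      by (subst nn_integral_cmult) (auto simp: mult_ac)
    also have "\<dots> \<le> ennreal \<bar>\<beta>\<bar> * (\<integral>\<^sup>+ t2. ennreal C * ennreal (1 / ((1 + (?x t2)\<^sup>2) * (1 + (?y t2)\<^sup>2))) \<partial>lborel)"
    proof (intro mult_left_mono nn_integral_mono)
      fix t2
      show "ennreal (1 / (1 + ?d\<^sup>2)) * indicator {0..1} (?x t2) \<le> ennreal C * ennreal (1 / ((1 + (?x t2)\<^sup>2) * (1 + (?y t2)\<^sup>2)))"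
      proof (cases "?x t2 \<in> {0..1}")
        case True
        have "ennreal (1 / (1 + ?d\<^sup>2)) \<le> ennreal (C * (1 / ((1 + (?x t2)\<^sup>2) * (1 + (?y t2)\<^sup>2))))"
          by (rule ennreal_leI[OF pointwise[OF True]])
        then show ?thesis using C True by (subst (asm) ennreal_mult) auto
      qed simp
    qed simp
    also have "\<dots> = ennreal (C * \<bar>\<beta>\<bar>) * (\<integral>\<^sup>+ t2. ennreal (1 / ((1 + (?x t2)\<^sup>2) * (1 + (?y t2)\<^sup>2))) \<partial>lborel)"
      using C by (subst nn_integral_cmult) (auto simp: ennreal_mult mult_ac)
    finally show "ennreal (1 / (1 + ?d\<^sup>2)) \<le> ennreal (C * \<bar>\<beta>\<bar>) *
        (\<integral>\<^sup>+ t2. ennreal (1 / ((1 + (?x t2)\<^sup>2) * (1 + (?y t2)\<^sup>2))) \<partial>lborel)" .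
  qed
qed

lemma growth_cond2_line_measure:
  assumes sets: "sets \<mu>1 = sets borel"
  shows "growth_cond2 (line_measure \<alpha> \<beta> \<gamma> \<delta> \<mu>1) \<longleftrightarrow>
    (\<integral>\<^sup>+ t1. \<integral>\<^sup>+ t2. ennreal (1 / ((1 + (\<alpha> * t1 + \<beta> * t2)\<^sup>2) * (1 + (\<gamma> * t1 + \<delta> * t2)\<^sup>2))) \<partial>lborel \<partial>\<mu>1) < \<infinity>"
proof -
  have "(\<lambda>t :: real \<times> real. 1 / ((1 + (fst t)\<^sup>2) * (1 + (snd t)\<^sup>2))) \<in> borel_measurable borel"
    by (intro borel_measurable_continuous_onI continuous_intros)
       (auto simp: add_pos_nonneg less_imp_neq[symmetric] sum_power2_eq_zero_iff add_nonneg_eq_0_iff)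
  then show ?thesis
    unfolding growth_cond2_def by (subst nn_integral_line_measure[OF sets]) auto
qed

lemma growth_cond2_line_measure_iff:
  assumes sets: "sets \<mu>1 = sets borel" and nz: "\<beta> \<noteq> 0 \<or> \<delta> \<noteq> 0"
  shows "growth_cond2 (line_measure \<alpha> \<beta> \<gamma> \<delta> \<mu>1) \<longleftrightarrow>
    (\<integral>\<^sup>+ t. ennreal (1 / (1 + ((\<alpha> * \<delta> - \<beta> * \<gamma>) * t)\<^sup>2)) \<partial>\<mu>1) < \<infinity>"
    (is "_ \<longleftrightarrow> ?R < \<infinity>")
proof -
  let ?J = "\<lambda>t1. \<integral>\<^sup>+ t2. ennreal (1 / ((1 + (\<alpha> * t1 + \<beta> * t2)\<^sup>2) * (1 + (\<gamma> * t1 + \<delta> * t2)\<^sup>2))) \<partial>lborel"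
  let ?w = "\<lambda>t. ennreal (1 / (1 + ((\<alpha> * \<delta> - \<beta> * \<gamma>) * t)\<^sup>2))"
  have id: "(\<lambda>t. t) \<in> borel_measurable \<mu>1" using sets by (simp add: measurable_ident_sets)
  then have w: "?w \<in> borel_measurable \<mu>1" by measurable
  have J: "?J \<in> borel_measurable \<mu>1"
  proof -
    have "(\<lambda>x. ennreal (1 / ((1 + (\<alpha> * fst x + \<beta> * snd x)\<^sup>2) * (1 + (\<gamma> * fst x + \<delta> * snd x)\<^sup>2))))
        \<in> borel_measurable (\<mu>1 \<Otimes>\<^sub>M lborel)"
      using measurable_compose[OF measurable_fst id] by measurable
    from lborel.borel_measurable_nn_integral_fst[OF this] show ?thesis by simp
  qed
  obtain K where K: "K < \<infinity>" "\<And>t1. ?J t1 \<le> K * ?w t1"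
    by (rule inner_weight_upper_bound[OF nz, of \<alpha> \<gamma>]) blast
  then have K': "ennreal (enn2real K) = K" by simp
  obtain k where k: "\<And>t1. ?w t1 \<le> ennreal k * ?J t1"
  proof (cases "\<beta> = 0")
    case False
    show ?thesis by (rule inner_weight_lower_bound[OF False, of \<alpha> \<delta> \<gamma>]) (rule that)
  next
    case True
    then have "\<delta> \<noteq> 0" using nz by simp
    \<comment> \<open>Interchanging the two coordinates reduces to the previous case; the
      determinant only changes sign, which its square does not see.\<close>
    then obtain k where k: "\<And>t1. ennreal (1 / (1 + ((\<gamma> * \<beta> - \<delta> * \<alpha>) * t1)\<^sup>2)) \<le> ennreal k *
      (\<integral>\<^sup>+ t2. ennreal (1 / ((1 + (\<gamma> * t1 + \<delta> * t2)\<^sup>2) * (1 + (\<alpha> * t1 + \<beta> * t2)\<^sup>2))) \<partial>lborel)"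
      by (rule inner_weight_lower_bound[of \<delta> \<gamma> \<beta> \<alpha>]) blast
    moreover have "((\<gamma> * \<beta> - \<delta> * \<alpha>) * t1)\<^sup>2 = ((\<alpha> * \<delta> - \<beta> * \<gamma>) * t1)\<^sup>2" for t1
      by (simp add: power2_eq_square algebra_simps)
    ultimately show ?thesis using that[of k] by (simp add: mult.commute)
  qed
  have "(\<integral>\<^sup>+ t1. ?J t1 \<partial>\<mu>1) < \<infinity>" if "?R < \<infinity>"
    using K(2) that by (intro nn_integral_finite_cmult_bound[OF w, of ?J "enn2real K"]) (simp_all only: K')
  moreover have "?R < \<infinity>" if "(\<integral>\<^sup>+ t1. ?J t1 \<partial>\<mu>1) < \<infinity>"
    using that by (rule nn_integral_finite_cmult_bound[OF J k])
  ultimately show ?thesis unfolding growth_cond2_line_measure[OF sets] by blast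
qed

text \<open>On a bounded interval the weight is bounded below by a positive constant, so bounded
  intervals have finite measure.\<close>

lemma sigma_finite_measure_of_weight:
  assumes sets: "sets \<mu>1 = sets borel"
    and fin: "(\<integral>\<^sup>+ t. ennreal (1 / (1 + (D * t)\<^sup>2)) \<partial>\<mu>1) < \<infinity>"
  shows "sigma_finite_measure \<mu>1"
proof
  let ?A = "\<lambda>n :: nat. {- real n..real n}"
  have space: "space \<mu>1 = UNIV" using sets_eq_imp_space_eq[OF sets] by simp
  have "(\<Union>n. ?A n) = UNIV"
  proof -
    have "\<exists>n :: nat. x \<in> ?A n" for x :: real
      using real_arch_simple[of "\<bar>x\<bar>"] by (auto simp: abs_le_iff minus_le_iff)
    then show ?thesis by blast
  qed
  moreover have "emeasure \<mu>1 (?A n) \<noteq> \<infinity>" for n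
  proof -
    have "indicator (?A n) t \<le> ennreal (1 + (D * n)\<^sup>2) * ennreal (1 / (1 + (D * t)\<^sup>2))" for t
    proof (cases "t \<in> ?A n")
      case True
      then have "\<bar>D * t\<bar> \<le> \<bar>D * n\<bar>" by (auto simp: abs_mult intro!: mult_left_mono)
      then have "(D * t)\<^sup>2 \<le> (D * n)\<^sup>2" by (simp add: abs_le_square_iff)
      moreover have "0 < 1 + (D * t)\<^sup>2" by (simp add: add_pos_nonneg)
      ultimately have "1 \<le> (1 + (D * n)\<^sup>2) * (1 / (1 + (D * t)\<^sup>2))"
        by (simp add: pos_le_divide_eq del: power_mult_distrib)
      then have "ennreal 1 \<le> ennreal ((1 + (D * n)\<^sup>2) * (1 / (1 + (D * t)\<^sup>2)))" by (rule ennreal_leI)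
      also have "\<dots> = ennreal (1 + (D * n)\<^sup>2) * ennreal (1 / (1 + (D * t)\<^sup>2))"
        by (rule ennreal_mult) auto
      finally show ?thesis using True by simp
    qed simp
    note bound = this
    have "(\<lambda>t. t) \<in> borel_measurable \<mu>1" using measurable_ident_sets[OF sets] by simp
    then have "(\<lambda>t. ennreal (1 / (1 + (D * t)\<^sup>2))) \<in> borel_measurable \<mu>1" by measurable
    then have "(\<integral>\<^sup>+ t. indicator (?A n) t \<partial>\<mu>1) < \<infinity>"
      using bound fin by (rule nn_integral_finite_cmult_bound)
    then show ?thesis using sets by (simp add: nn_integral_indicator)
  qed
  ultimately show "\<exists>A. countable A \<and> A \<subseteq> sets \<mu>1 \<and> \<Union> A = space \<mu>1 \<and> (\<forall>a\<in>A. emeasure \<mu>1 a \<noteq> \<infinity>)"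
    using sets space by (intro exI[of _ "range ?A"]) auto
qed

lemma weight_finite_iff_growth_cond1:
  assumes sets: "sets \<mu>1 = sets borel" and D: "D \<noteq> 0"
  shows "(\<integral>\<^sup>+ t. ennreal (1 / (1 + (D * t)\<^sup>2)) \<partial>\<mu>1) < \<infinity> \<longleftrightarrow> growth_cond1 \<mu>1"
proof -
  have comp: "ennreal (1 / (1 + u\<^sup>2)) \<le> ennreal C * ennreal (1 / (1 + v\<^sup>2))"
    if "C \<ge> 0" "1 + v\<^sup>2 \<le> C * (1 + u\<^sup>2)" for u v C :: real
  proof -
    have "1 / (1 + u\<^sup>2) \<le> C * (1 / (1 + v\<^sup>2))"
      using that by (simp add: divide_simps add_pos_nonneg add_nonneg_eq_0_iff)
    then show ?thesis using that(1) by (metis ennreal_leI ennreal_mult' )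
  qed
  have [measurable]: "(\<lambda>t. t) \<in> borel_measurable \<mu>1" using sets by (simp add: measurable_ident_sets)
  have "1 + t\<^sup>2 \<le> (1 + 1 / D\<^sup>2) * (1 + (D * t)\<^sup>2)" for t
    using D by (simp add: power_mult_distrib algebra_simps)
  then have c1: "ennreal (1 / (1 + (D * t)\<^sup>2)) \<le> ennreal (1 + 1 / D\<^sup>2) * ennreal (1 / (1 + t\<^sup>2))" for t
    by (intro comp) auto
  have "1 + (D * t)\<^sup>2 \<le> (1 + D\<^sup>2) * (1 + t\<^sup>2)" for t
    by (simp add: power_mult_distrib algebra_simps)
  then have c2: "ennreal (1 / (1 + t\<^sup>2)) \<le> ennreal (1 + D\<^sup>2) * ennreal (1 / (1 + (D * t)\<^sup>2))" for t
    by (intro comp) auto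
  show ?thesis unfolding growth_cond1_def
    by (intro iffI; (rule nn_integral_finite_cmult_bound[OF _ c2] nn_integral_finite_cmult_bound[OF _ c1];
      (assumption | measurable)))
qed

text \<open>For \<open>D = 0\<close> the weight is constantly \<open>1\<close>. This is the source
  of the division between finite measures and condition (G).\<close>

lemma weight_finite_iff:
  assumes sets: "sets \<mu>1 = sets borel"
  shows "(\<integral>\<^sup>+ t. ennreal (1 / (1 + (D * t)\<^sup>2)) \<partial>\<mu>1) < \<infinity> \<longleftrightarrow>
    (if D = 0 then finite_measure \<mu>1 else growth_cond1 \<mu>1)"
proof (cases "D = 0")
  case True
  have "finite_measure \<mu>1 \<longleftrightarrow> emeasure \<mu>1 (space \<mu>1) \<noteq> \<infinity>"
    by (auto simp: finite_measure.emeasure_finite intro: finite_measureI)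
  then show ?thesis using True by (simp add: less_top)
qed (use weight_finite_iff_growth_cond1[OF sets] in simp)

section \<open>The Nevanlinna condition for line measures\<close>

text \<open>As functions of \<open>t2\<close> the two factors have double poles at \<open>p\<close>
  and \<open>q\<close>. The sign of \<open>Im p\<close> is that of \<open>\<beta>\<close>, the sign
  of \<open>Im q\<close> is opposite to that of \<open>\<delta>\<close>, so the difference of the
  signs is \<open>sgn \<beta> + sgn \<delta>\<close>. The factor \<open>\<beta> * \<delta>\<close>
  also makes the formula cover the case of a missing pole.\<close>

lemma inner_nevanlinna_integral:
  fixes \<alpha> \<beta> \<gamma> \<delta> t1 :: real
  assumes z: "0 < Im z1" "0 < Im z2" and nz: "\<beta> \<noteq> 0 \<or> \<delta> \<noteq> 0"
  shows "(LINT t2|lborel. 1 / ((of_real (\<alpha> * t1 + \<beta> * t2) - z1)\<^sup>2 * (of_real (\<gamma> * t1 + \<delta> * t2) - cnj z2)\<^sup>2))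
    = 2 * pi * \<i> * of_real ((sgn \<beta> + sgn \<delta>) * (\<beta> * \<delta>)) *
      (1 / (of_real ((\<alpha> * \<delta> - \<beta> * \<gamma>) * t1) - of_real \<delta> * z1 + of_real \<beta> * cnj z2) ^ 3)"
    (is "?L = _")
proof -
  define p where "p = (z1 - of_real (\<alpha> * t1)) / of_real \<beta>"
  define q where "q = (cnj z2 - of_real (\<gamma> * t1)) / of_real \<delta>"
  have p: "of_real (\<alpha> * t1 + \<beta> * t2) - z1 = of_real \<beta> * (of_real t2 - p)" if "\<beta> \<noteq> 0" for t2

  proof -
    have "of_real \<beta> * p = z1 - of_real (\<alpha> * t1)" using that by (simp add: p_def)
    then show ?thesis by (simp add: right_diff_distrib)
  qed
  have q: "of_real (\<gamma> * t1 + \<delta> * t2) - cnj z2 = of_real \<delta> * (of_real t2 - q)" if "\<delta> \<noteq> 0" for t2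

  proof -
    have "of_real \<delta> * q = cnj z2 - of_real (\<gamma> * t1)" using that by (simp add: q_def)
    then show ?thesis by (simp add: right_diff_distrib)
  qed
  have Im: "Im p = Im z1 / \<beta>" "Im q = - (Im z2 / \<delta>)"
    by (simp_all add: p_def q_def Im_divide_of_real)
  consider "\<beta> = 0" "\<delta> \<noteq> 0" | "\<delta> = 0" "\<beta> \<noteq> 0" | "\<beta> \<noteq> 0" "\<delta> \<noteq> 0" using nz by blast
  then show ?thesis
  proof cases
    case 1
    have "?L = (LINT t2|lborel. 1 / ((of_real (\<alpha> * t1) - z1)\<^sup>2 * (of_real \<delta>)\<^sup>2) * (1 / (complex_of_real t2 - q)\<^sup>2))"
      unfolding q[OF 1(2)] using 1(1) by (simp add: power_mult_distrib mult.assoc)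
    also have "\<dots> = 0"
      using 1 z integral_inverse_cauchy_power2[of q] unfolding integral_mult_right_zero by (simp add: Im)
    finally show ?thesis using 1 by simp
  next
    case 2
    have "?L = (LINT t2|lborel. 1 / ((of_real (\<gamma> * t1) - cnj z2)\<^sup>2 * (of_real \<beta>)\<^sup>2) * (1 / (complex_of_real t2 - p)\<^sup>2))"
      unfolding p[OF 2(2)] using 2(1) by (simp add: power_mult_distrib mult_ac)
    also have "\<dots> = 0"
      using 2 z integral_inverse_cauchy_power2[of p] unfolding integral_mult_right_zero by (simp add: Im)
    finally show ?thesis using 2 by simp
  next
    case 3
    define X where "X = of_real ((\<alpha> * \<delta> - \<beta> * \<gamma>) * t1) - of_real \<delta> * z1 + of_real \<beta> * cnj z2"
    have "p - q = - (X / of_real (\<beta> * \<delta>))"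
      using 3 by (simp add: p_def q_def X_def field_simps)
    then have pq: "(p - q) ^ 3 = - (X ^ 3 / of_real (\<beta> * \<delta>) ^ 3)"
      by (simp add: power_divide)
    have "?L = (LINT t2|lborel. 1 / (of_real (\<beta> * \<delta>))\<^sup>2 * (1 / ((complex_of_real t2 - p)\<^sup>2 * (complex_of_real t2 - q)\<^sup>2)))"
      unfolding p[OF 3(1)] q[OF 3(2)] by (simp add: power_mult_distrib mult_ac)
    also have "\<dots> = 1 / (of_real (\<beta> * \<delta>))\<^sup>2 *
        (- 2 * pi * \<i> * of_real (sgn (Im p) - sgn (Im q)) / (p - q) ^ 3)"
      unfolding integral_mult_right_zero
      by (subst integral_inverse_two_double_poles) (use 3 z in \<open>auto simp: Im\<close>)
    also have "sgn (Im p) - sgn (Im q) = sgn \<beta> + sgn \<delta>"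
      using z by (simp add: Im sgn_divide)
    also have "1 / (of_real (\<beta> * \<delta>))\<^sup>2 * (- 2 * pi * \<i> * of_real (sgn \<beta> + sgn \<delta>) / (p - q) ^ 3)
        = 2 * pi * \<i> * of_real ((sgn \<beta> + sgn \<delta>) * (\<beta> * \<delta>)) * (1 / X ^ 3)"
    proof -
      \<comment> \<open>\<open>X\<close> can vanish when \<open>\<beta>\<close> and
        \<open>\<delta>\<close> have opposite signs; both sides are then \<open>0\<close> through
        division by \<open>0\<close>.\<close>
      have "1 / r\<^sup>2 * (- 2 * pi * \<i> * s / - (X ^ 3 / r ^ 3)) = 2 * pi * \<i> * (s * r) * (1 / X ^ 3)"
        if "r \<noteq> 0" for r s :: complex
        using that by (cases "X = 0") (auto simp: field_simps eval_nat_numeral)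
      from this[of "of_real (\<beta> * \<delta>)" "of_real (sgn \<beta> + sgn \<delta>)"]
      show ?thesis using 3 unfolding pq by simp
    qed
    finally show ?thesis by (simp only: X_def)
  qed
qed

text \<open>By Fubini the condition becomes a constant times an integral over \<open>\<mu>1\<close>,
  and the constant is nonzero exactly for \<open>\<beta> * \<delta> > 0\<close>. The growth
  condition supplies both the integrability and the sigma-finiteness.\<close>

lemma nevanlinna_cond2_line_measure_iff:
  assumes sets: "sets \<mu>1 = sets borel" and nz: "\<beta> \<noteq> 0 \<or> \<delta> \<noteq> 0"
    and growth: "growth_cond2 (line_measure \<alpha> \<beta> \<gamma> \<delta> \<mu>1)"
  shows "nevanlinna_cond2 (line_measure \<alpha> \<beta> \<gamma> \<delta> \<mu>1) \<longleftrightarrow> (0 < \<beta> * \<delta> \<longrightarrow>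
    (\<forall>z1 \<in> upper_half_plane. \<forall>z2 \<in> upper_half_plane.
      (LINT t1|\<mu>1. 1 / (of_real ((\<alpha> * \<delta> - \<beta> * \<gamma>) * t1) - of_real \<delta> * z1 + of_real \<beta> * cnj z2) ^ 3) = 0))"
proof -
  let ?\<mu> = "line_measure \<alpha> \<beta> \<gamma> \<delta> \<mu>1"
  let ?c = "2 * pi * \<i> * of_real ((sgn \<beta> + sgn \<delta>) * (\<beta> * \<delta>))"
  let ?X = "\<lambda>z1 z2 t1. of_real ((\<alpha> * \<delta> - \<beta> * \<gamma>) * t1) - of_real \<delta> * z1 + of_real \<beta> * cnj z2"
  have sf: "sigma_finite_measure \<mu>1"
    using growth unfolding growth_cond2_line_measure_iff[OF sets nz]
    by (rule sigma_finite_measure_of_weight[OF sets])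
  note [measurable] = fst_snd_borel_measurable[OF sets_line_measure[of \<alpha> \<beta> \<gamma> \<delta> \<mu>1]]
  have eq: "(LINT t|?\<mu>. 1 / ((of_real (fst t) - z1)\<^sup>2 * (of_real (snd t) - cnj z2)\<^sup>2)) =
      ?c * (LINT t1|\<mu>1. 1 / ?X z1 z2 t1 ^ 3)" if z: "0 < Im z1" "0 < Im z2" for z1 z2
  proof -
    have Im: "Im z1 \<noteq> 0" "Im (cnj z2) \<noteq> 0" using z by auto
    obtain C where C: "\<And>t. norm (1 / (of_real t - z1)\<^sup>2) \<le> C / (1 + t\<^sup>2)"
      using cauchy_kernel_bounds[OF Im(1,1)] by metis
    obtain D where D: "\<And>t. norm (1 / (of_real t - cnj z2)\<^sup>2) \<le> D / (1 + t\<^sup>2)"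
      using cauchy_kernel_bounds[OF Im(2,2)] by metis
    let ?f = "\<lambda>t. 1 / ((complex_of_real (fst t) - z1)\<^sup>2 * (of_real (snd t) - cnj z2)\<^sup>2)"
    have "norm (?f t) \<le> (C * D) * poisson_weight2 t" for t
      using norm_mult_poisson_weight2_le[OF C D, of t] by simp
    then have "integrable ?\<mu> ?f"
      by (intro integrable_poisson_weight2_bound[OF sets_line_measure growth]) measurable
    then have "(LINT t|?\<mu>. ?f t) = (LINT t1|\<mu>1. LINT t2|lborel. ?f (\<alpha> * t1 + \<beta> * t2, \<gamma> * t1 + \<delta> * t2))"
      by (rule integral_line_measure[OF sets sf])
    also have "\<dots> = (LINT t1|\<mu>1. ?c * (1 / ?X z1 z2 t1 ^ 3))"
      unfolding fst_conv snd_conv inner_nevanlinna_integral[OF z nz] ..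
    finally show ?thesis unfolding integral_mult_right_zero .
  qed
  have "?c = 0 \<longleftrightarrow> \<not> 0 < \<beta> * \<delta>"
    by (auto simp: sgn_if zero_less_mult_iff)
  then show ?thesis
    unfolding nevanlinna_cond2_def upper_half_plane_def using eq by auto
qed

text \<open>For \<open>\<alpha>\<delta> = \<beta>\<gamma>\<close> the Nevanlinna integrand is
  constant in \<open>t1\<close>. Finiteness matters: over an infinite measure the integral of a
  nonzero constant takes the default value \<open>0\<close>.\<close>

lemma finite_measure_constant_integral_eq_0_iff:
  assumes "sets \<mu>1 = sets (borel :: real measure)" "finite_measure \<mu>1" and "c \<noteq> (0 :: complex)"
  shows "(LINT t|\<mu>1. c) = 0 \<longleftrightarrow> \<mu>1 = null_measure borel"
proof
  assume "(LINT t|\<mu>1. c) = 0"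
  then have "measure \<mu>1 (space \<mu>1) = 0" using assms(3) by simp
  then have "emeasure \<mu>1 (space \<mu>1) = 0"
    using finite_measure.emeasure_eq_measure[OF assms(2)] by simp
  then have "emeasure \<mu>1 A = 0" if "A \<in> sets \<mu>1" for A
    using emeasure_space[of \<mu>1 A] by simp
  then show "\<mu>1 = null_measure borel"
    using assms(1) by (intro measure_eqI) auto
qed simp

text \<open>The inner integrand is a positive constant in \<open>t2\<close>, so the inner integral
  is infinite for every \<open>t1\<close>.\<close>

lemma growth_cond2_line_measure_point:
  assumes sets: "sets \<mu>1 = sets borel" and growth: "growth_cond2 (line_measure \<alpha> 0 \<gamma> 0 \<mu>1)"
  shows "\<mu>1 = null_measure borel"
proof -
  let ?w = "\<lambda>t1 :: real. 1 / ((1 + (\<alpha> * t1)\<^sup>2) * (1 + (\<gamma> * t1)\<^sup>2))"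
  have pos: "?w t1 > 0" for t1 by (simp add: add_pos_nonneg)
  have "(\<integral>\<^sup>+ t1. \<integral>\<^sup>+ t2. ennreal (?w t1) \<partial>lborel \<partial>\<mu>1) < \<infinity>"
    using growth unfolding growth_cond2_line_measure[OF sets] by simp
  also have "(\<integral>\<^sup>+ t1. \<integral>\<^sup>+ (t2 :: real). ennreal (?w t1) \<partial>lborel \<partial>\<mu>1) = (\<integral>\<^sup>+ t1. \<infinity> \<partial>\<mu>1)"
    using pos by (intro nn_integral_cong) (simp add: ennreal_mult_top add_nonneg_eq_0_iff)
  finally have "emeasure \<mu>1 (space \<mu>1) = 0"
    by (simp add: ennreal_top_mult split: if_splits)
  then have "emeasure \<mu>1 A = 0" if "A \<in> sets \<mu>1" for A
    using emeasure_space[of \<mu>1 A] by simp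
  then show ?thesis using sets by (intro measure_eqI) auto
qed

text \<open>The second hypothesis sets aside \<open>\<beta> = \<delta> = 0\<close> with
  \<open>\<mu>1\<close> zero: the line measure is then zero and represents the function
  \<open>0\<close>, although none of the listed cases applies.\<close>

theorem theorem3p3:
  fixes \<alpha> \<beta> \<gamma> \<delta> :: real and \<mu>1 :: "real measure"
  assumes borel_\<mu>1: "sets \<mu>1 = sets borel"
    and nondegenerate: "\<not> (\<beta> = 0 \<and> \<delta> = 0 \<and> \<mu>1 = null_measure borel)"
  shows "(\<exists>q. herglotz_nevanlinna2 q \<and> representing_measure2 (line_measure \<alpha> \<beta> \<gamma> \<delta> \<mu>1) q) \<longleftrightarrow>
      (\<alpha> = 0 \<and> \<beta> = 0 \<and> \<delta> \<noteq> 0 \<and> finite_measure \<mu>1)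
    \<or> (\<alpha> \<noteq> 0 \<and> \<beta> = 0 \<and> \<delta> \<noteq> 0 \<and> growth_cond1 \<mu>1)
    \<or> (\<beta> \<noteq> 0 \<and> \<gamma> = 0 \<and> \<delta> = 0 \<and> finite_measure \<mu>1)
    \<or> (\<beta> \<noteq> 0 \<and> \<gamma> \<noteq> 0 \<and> \<delta> = 0 \<and> growth_cond1 \<mu>1)
    \<or> (\<beta> * \<delta> < 0 \<and> \<alpha> * \<delta> - \<beta> * \<gamma> = 0 \<and> finite_measure \<mu>1)
    \<or> (\<beta> * \<delta> < 0 \<and> \<alpha> * \<delta> - \<beta> * \<gamma> \<noteq> 0 \<and> growth_cond1 \<mu>1)
    \<or> (\<beta> * \<delta> > 0 \<and> \<alpha> * \<delta> - \<beta> * \<gamma> = 0 \<and> \<mu>1 = null_measure borel)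
    \<or> (\<beta> * \<delta> > 0 \<and> \<alpha> * \<delta> - \<beta> * \<gamma> \<noteq> 0 \<and> growth_cond1 \<mu>1 \<and>
        (\<forall>z1 \<in> upper_half_plane. \<forall>z2 \<in> upper_half_plane.
           (LINT t1|\<mu>1. 1 / (of_real ((\<alpha> * \<delta> - \<beta> * \<gamma>) * t1) - of_real \<delta> * z1
                               + of_real \<beta> * cnj z2)^3) = 0))"
    (is "?ex \<longleftrightarrow> ?cases")
proof (cases "\<beta> = 0 \<and> \<delta> = 0")
  case True
  then show ?thesis
    using growth_cond2_line_measure_point[OF borel_\<mu>1] nondegenerate
    by (auto simp: ex_representing_measure2_iff)
next
  case False
  then have nz: "\<beta> \<noteq> 0 \<or> \<delta> \<noteq> 0" by blast
  \<comment> \<open>For \<open>\<beta> = 0\<close> this is \<open>\<alpha> * \<delta>\<close>, for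
    \<open>\<delta> = 0\<close> it is \<open>- \<beta> * \<gamma>\<close>; so the splitting by
    \<open>D = 0\<close> also yields the subcases by \<open>\<alpha>\<close> and
    \<open>\<gamma>\<close>.\<close>
  define D where "D = \<alpha> * \<delta> - \<beta> * \<gamma>"
  let ?N = "\<forall>z1 \<in> upper_half_plane. \<forall>z2 \<in> upper_half_plane.
    (LINT t1|\<mu>1. 1 / (of_real (D * t1) - of_real \<delta> * z1 + of_real \<beta> * cnj z2) ^ 3) = 0"
  have growth: "growth_cond2 (line_measure \<alpha> \<beta> \<gamma> \<delta> \<mu>1) \<longleftrightarrow> (if D = 0 then finite_measure \<mu>1 else growth_cond1 \<mu>1)"
    unfolding D_def growth_cond2_line_measure_iff[OF borel_\<mu>1 nz] by (rule weight_finite_iff[OF borel_\<mu>1])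
  have ex: "?ex \<longleftrightarrow> (if D = 0 then finite_measure \<mu>1 else growth_cond1 \<mu>1) \<and> (0 < \<beta> * \<delta> \<longrightarrow> ?N)"
    unfolding ex_representing_measure2_iff[OF sets_line_measure] growth[symmetric]
    using nevanlinna_cond2_line_measure_iff[OF borel_\<mu>1 nz] unfolding D_def by blast
  have null: "finite_measure \<mu>1 \<and> ?N \<longleftrightarrow> \<mu>1 = null_measure borel" if "D = 0" "0 < \<beta> * \<delta>"
  proof (intro iffI conjI; (elim conjE)?)
    assume fin: "finite_measure \<mu>1" and N: ?N
    \<comment> \<open>One choice of points suffices, as the integrand no longer depends on
      \<open>t1\<close>. At \<open>z1 = z2 = i\<close> its base is
      \<open>-(\<beta> + \<delta>) i\<close>, nonzero because \<open>\<beta>\<close> and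
      \<open>\<delta>\<close> have the same sign.\<close>
    have "(LINT t1|\<mu>1. 1 / (- of_real \<delta> * \<i> + of_real \<beta> * cnj \<i>) ^ 3) = 0"
      using N[THEN bspec, THEN bspec, of \<i> \<i>] that(1) by (simp add: upper_half_plane_def)
    moreover have "- of_real \<delta> * \<i> + of_real \<beta> * cnj \<i> \<noteq> 0"
      using that(2) by (auto simp: complex_eq_iff zero_less_mult_iff)
    ultimately show "\<mu>1 = null_measure borel"
      using finite_measure_constant_integral_eq_0_iff[OF borel_\<mu>1 fin] by (metis divide_eq_0_iff power_not_zero zero_neq_one)
  qed (auto intro!: finite_measureI)
  have sgn: "\<beta> = 0 \<and> \<delta> \<noteq> 0 \<or> \<beta> \<noteq> 0 \<and> \<delta> = 0 \<or> \<beta> * \<delta> < 0 \<or> 0 < \<beta> * \<delta>"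
    using nz by (metis linorder_neqE mult_eq_0_iff)
  then show ?thesis
  proof (elim disjE)
    assume "0 < \<beta> * \<delta>"
    then show ?thesis using ex null unfolding D_def[symmetric] by auto
  qed (use ex in \<open>auto simp: D_def\<close>)
qed

end
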